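(* Let $\Xi\subseteq\mathbb{R}^m$, equipped with a metric $d$, be a complete separable metric space, $p\in[1,\infty)$, $\theta>0$, $\alpha\in(0,1)$, $c\in\mathbb{R}^n$, $X\subseteq\mathbb{R}^n$ closed and convex, $\widehat\xi_1,\dots,\widehat\xi_N\in\Xi$, and let $F:\mathbb{R}^n\times\Xi\to\mathbb{R}$ be continuous and such that (i) for every $\xi\in\Xi$, $x\mapsto F(x,\xi)$ is convex on $X$; (ii) for every $x\in X$, $\xi\mapsto F(x,\xi)$ is bounded on $\Xi$. Let $\mathcal{M}^\theta_N$ be the $p$-Wasserstein ball of radius $\theta$ around the empirical distribution of the samples. Then the problem $$\min\{c^\top x : x\in\widehat{X}_{\mathtt{CDCP}}\},\qquad \widehat{X}_{\mathtt{CDCP}}:=\Bigl\{x\in X\;\Big|\;\sup_{\mathbb{P}\in\mathcal{M}^\theta_N}\ \inf_{t\in\mathbb{R}}\bigl[\mathbb{E}_{\mathbb{P}}[(F(x,\xi)+t)_+]-t\alpha\bigr]\le 0\Bigr\}$$ is equivalent to the following convex program in the variables $(x,\lambda,t,\{s_i\}_{i=1}^N)$: $$\begin{aligned}\min\ & c^\top x\\ \text{s.t. } & \lambda\theta^p+\tfrac1N\textstyle\sum_{i=1}^N s_i\le t\alpha,\\ & s_i\ge\sup_{\xi\in\Xi}\bigl[F(x,\xi)+t-\lambda d^p(\xi,\widehat\xi_i)\bigr],\quad \forall i\in\{1,\dots,N\},\\ & \lambda\ge0,\ t\in\mathbb{R},\ x\in X,\ s_i\ge0,\quad \forall i\in\{1,\dots,N\}.\end{aligned}$$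 Specifically, $x\in\widehat{X}_{\mathtt{CDCP}}$ if and only if there exists $(\lambda,t,\{s_i\}_{i=1}^N)$ such that $(x,\lambda,t,\{s_i\}_{i=1}^N)$ is feasible for this program.
   Context: $z_+:=\max(z,0)$. $\mathcal{P}_p(\Xi)$ is the set of Borel probability measures on $\Xi$ with finite $p$-th moment. For $\mu,\nu\in\mathcal{P}_p(\Xi)$, $(W_p(\mu,\nu))^p:=\min_{\gamma}\int_{\Xi\times\Xi}d^p(\xi,\omega)\,\gamma(d\xi,d\omega)$ over all probability measures $\gamma$ on $\Xi\times\Xi$ with marginals $\mu,\nu$. $\widehat{\mathbb{P}}_N:=\frac1N\sum_{i=1}^N\delta_{\widehat\xi_i}$ and $\mathcal{M}^\theta_N:=\{\mu\in\mathcal{P}_p(\Xi) : W_p(\mu,\widehat{\mathbb{P}}_N)\le\theta\}$. *)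

theory Defs
  imports "HOL-Probability.Probability"
begin

text \<open>
  A metric space (a subset of \<open>\<real>\<^sup>m\<close> with its own metric, not necessarily the Euclidean one) is
  an element of the library type \<^typ>\<open>'a metric\<close>, with carrier \<^const>\<open>mspace\<close> and distance
  \<^const>\<open>mdist\<close>. All topological and measurability notions refer to that metric.
\<close>

definition borel_of_metric :: "'a metric \<Rightarrow> 'a measure" where
  "borel_of_metric M = sigma (mspace M) {U. openin (mtopology_of M) U}"

definition prob_measures_moment :: "real \<Rightarrow> 'a metric \<Rightarrow> 'a measure set" where
  "prob_measures_moment p M =
     {\<mu>. prob_space \<mu> \<and> sets \<mu> = sets (borel_of_metric M) \<and>
         (\<exists>\<xi>\<^sub>0\<in>mspace M. (\<integral>\<^sup>+ \<xi>. ennreal (mdist M \<xi> \<xi>\<^sub>0 powr p) \<partial>\<mu>) < \<infinity>)}"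

text \<open>
  On a separable space the product of the Borel algebras is the Borel algebra of the product.
\<close>

definition couplings :: "'a metric \<Rightarrow> 'a measure \<Rightarrow> 'a measure \<Rightarrow> ('a \<times> 'a) measure set" where
  "couplings M \<mu> \<nu> =
     {\<gamma>. prob_space \<gamma> \<and>
         sets \<gamma> = sets (borel_of_metric M \<Otimes>\<^sub>M borel_of_metric M) \<and>
         distr \<gamma> (borel_of_metric M) fst = \<mu> \<and>
         distr \<gamma> (borel_of_metric M) snd = \<nu>}"

text \<open>
  Between measures with finite \<open>p\<close>-th moment the optimal transport cost is finite, so that
  \<^const>\<open>enn2real\<close> (which sends \<open>\<infinity>\<close> to \<open>0\<close>) loses nothing there; the distance must not be used for
  other measures. On a complete separable space the infimum is attained.
\<close>

definition wasserstein :: "real \<Rightarrow> 'a metric \<Rightarrow> 'a measure \<Rightarrow> 'a measure \<Rightarrow> real" where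
  "wasserstein p M \<mu> \<nu> =
     enn2real (INF \<gamma>\<in>couplings M \<mu> \<nu>.
       \<integral>\<^sup>+ (\<xi>, \<omega>). ennreal (mdist M \<xi> \<omega> powr p) \<partial>\<gamma>) powr (1 / p)"

definition empirical :: "'a metric \<Rightarrow> ('k::finite \<Rightarrow> 'a) \<Rightarrow> 'a measure" where
  "empirical M \<xi>s =
     measure_of (mspace M) (sets (borel_of_metric M))
       (\<lambda>A. (\<Sum>i\<in>UNIV. emeasure (return (borel_of_metric M) (\<xi>s i)) A) / of_nat CARD('k))"

lemma emeasure_empirical:
  fixes \<xi>s :: "'k::finite \<Rightarrow> 'a"
  assumes "A \<in> sets (borel_of_metric M)"
  shows "emeasure (empirical M \<xi>s) A =
    (\<Sum>i\<in>UNIV. emeasure (return (borel_of_metric M) (\<xi>s i)) A) / of_nat CARD('k)"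
proof (rule emeasure_measure_of[OF empirical_def])
  have sp: "space (borel_of_metric M) = mspace M"
    unfolding borel_of_metric_def
    by (rule space_measure_of) (use openin_subset in fastforce)
  show sub: "sets (borel_of_metric M) \<subseteq> Pow (mspace M)"
    using sets.space_closed[of "borel_of_metric M"] sp by simp
  have sig: "sets (measure_of (mspace M) (sets (borel_of_metric M))
       (\<lambda>A. (\<Sum>i\<in>UNIV. emeasure (return (borel_of_metric M) (\<xi>s i)) A) / of_nat CARD('k)))
     = sets (borel_of_metric M)"
    using sets.sigma_sets_eq[of "borel_of_metric M"] sub sp by simp
  then show "A \<in> sets (empirical M \<xi>s)"
    using assms by (simp add: empirical_def)
  show "positive (sets (empirical M \<xi>s))
     (\<lambda>A. (\<Sum>i\<in>UNIV. emeasure (return (borel_of_metric M) (\<xi>s i)) A) / of_nat CARD('k))"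
    by (simp add: positive_def)
  show "countably_additive (sets (empirical M \<xi>s))
     (\<lambda>A. (\<Sum>i\<in>UNIV. emeasure (return (borel_of_metric M) (\<xi>s i)) A) / of_nat CARD('k))"
  proof (rule countably_additiveI)
    fix B :: "nat \<Rightarrow> 'a set"
    assume B: "range B \<subseteq> sets (empirical M \<xi>s)" "disjoint_family B"
    then have B': "range B \<subseteq> sets (return (borel_of_metric M) (\<xi>s i))" for i
      by (simp add: empirical_def sig)
    have "(\<Sum>j. (\<Sum>i\<in>UNIV. emeasure (return (borel_of_metric M) (\<xi>s i)) (B j)) / of_nat CARD('k))
       = (\<Sum>j. (\<Sum>i\<in>UNIV. emeasure (return (borel_of_metric M) (\<xi>s i)) (B j))) / of_nat CARD('k)"
      by simp
    also have "(\<Sum>j. (\<Sum>i\<in>UNIV. emeasure (return (borel_of_metric M) (\<xi>s i)) (B j)))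
       = (\<Sum>i\<in>UNIV. (\<Sum>j. emeasure (return (borel_of_metric M) (\<xi>s i)) (B j)))"
      by (rule suminf_sum) simp
    also have "\<dots> = (\<Sum>i\<in>UNIV. emeasure (return (borel_of_metric M) (\<xi>s i)) (\<Union>j. B j))"
      by (intro sum.cong refl suminf_emeasure B' B(2))
    finally show "(\<Sum>j. (\<Sum>i\<in>UNIV. emeasure (return (borel_of_metric M) (\<xi>s i)) (B j)) / of_nat CARD('k))
       = (\<Sum>i\<in>UNIV. emeasure (return (borel_of_metric M) (\<xi>s i)) (\<Union>j. B j)) / of_nat CARD('k)" .
  qed
qed

definition wasserstein_ball ::
  "real \<Rightarrow> real \<Rightarrow> 'a metric \<Rightarrow> ('k::finite \<Rightarrow> 'a) \<Rightarrow> 'a measure set" where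
  "wasserstein_ball p \<theta> M \<xi>s =
     {\<mu> \<in> prob_measures_moment p M. wasserstein p M \<mu> (empirical M \<xi>s) \<le> \<theta>}"

definition X_CDCP ::
  "real \<Rightarrow> real \<Rightarrow> real \<Rightarrow> 'a metric \<Rightarrow> ('k::finite \<Rightarrow> 'a) \<Rightarrow> 'x set \<Rightarrow> ('x \<Rightarrow> 'a \<Rightarrow> real) \<Rightarrow> 'x set"
  where
  "X_CDCP p \<theta> \<alpha> M \<xi>s X F =
     {x \<in> X. (SUP P\<in>wasserstein_ball p \<theta> M \<xi>s.
                INF t. ereal ((\<integral>\<xi>. max (F x \<xi> + t) 0 \<partial>P) - t * \<alpha>)) \<le> 0}"

definition worst_case ::
  "real \<Rightarrow> 'a metric \<Rightarrow> ('x \<Rightarrow> 'a \<Rightarrow> real) \<Rightarrow> 'a \<Rightarrow> 'x \<Rightarrow> real \<Rightarrow> real \<Rightarrow> ereal" where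
  "worst_case p M F \<zeta> x l t =
     (SUP \<xi>\<in>mspace M. ereal (F x \<xi> + t - l * mdist M \<xi> \<zeta> powr p))"

text \<open>
  The variables of the program are \<open>(x, \<lambda>, t, s)\<close>; the domain collects the constraints
  \<open>\<lambda> \<ge> 0\<close>, \<open>x \<in> X\<close>, \<open>s\<^sub>i \<ge> 0\<close>.
\<close>

definition program_domain :: "'x set \<Rightarrow> ('x \<times> real \<times> real \<times> (real ^ 'k)) set" where
  "program_domain X = {(x, l, t, s). x \<in> X \<and> l \<ge> 0 \<and> (\<forall>i. s $ i \<ge> 0)}"

definition program_feasible ::
  "real \<Rightarrow> real \<Rightarrow> real \<Rightarrow> 'a metric \<Rightarrow> ('k::finite \<Rightarrow> 'a) \<Rightarrow> 'x set \<Rightarrow> ('x \<Rightarrow> 'a \<Rightarrow> real) \<Rightarrow>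
   ('x \<times> real \<times> real \<times> (real ^ 'k)) set"
  where
  "program_feasible p \<theta> \<alpha> M \<xi>s X F =
     {(x, l, t, s) \<in> program_domain X.
        l * \<theta> powr p + (\<Sum>i\<in>UNIV. s $ i) / real CARD('k) \<le> t * \<alpha> \<and>
        (\<forall>i. ereal (s $ i) \<ge> worst_case p M F (\<xi>s i) x l t)}"

end

theory Submission
  imports Defs
begin

text \<open>
  Weak duality integrates the constraint \<open>(F + t)\<^sub>+ \<le> s\<^sub>i + \<lambda> d\<^sup>p\<close> against couplings that are almost
  optimal. For the converse, let \<open>\<pi>\<close> range over the finitely supported plans that start from the
  empirical measure. The Lagrangian \<open>E\<^sub>\<pi>[(F + t)\<^sub>+ - \<lambda> d\<^sup>p] + \<lambda> \<theta>\<^sup>p - t \<alpha>\<close> is affine in \<open>\<pi>\<close> and convex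
  in \<open>(t, \<lambda>)\<close>, and infeasibility of the program says that every \<open>(t, \<lambda>)\<close> admits a plan with positive
  Lagrangian. On a compact rectangle finitely many plans suffice, and separating convex sets in the
  plane merges two plans at a time into a single one. Boundedness of \<open>F\<close> takes care of the values of
  \<open>t\<close> outside the rectangle, and a final mixture with the identity plan restores the cost bound.
\<close>

section \<open>Borel sets of a metric space\<close>

lemma space_borel_of_metric [simp]: "space (borel_of_metric M) = mspace M"
  unfolding borel_of_metric_def
  by (rule space_measure_of) (use openin_subset in fastforce)

lemma sets_borel_of_metric_openin: "openin (mtopology_of M) U \<Longrightarrow> U \<in> sets (borel_of_metric M)"
  unfolding borel_of_metric_def
  by (subst sets_measure_of) (use openin_subset in fastforce)+

text \<open>Metric topologies are Hausdorff, so points are closed. Intersecting with the carrier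
  keeps the statement free of side conditions: for \<open>z\<close> outside it the set is
  empty.\<close>

lemma sets_borel_of_metric_singleton: "{z} \<inter> mspace M \<in> sets (borel_of_metric M)"
proof -
  have "closedin (mtopology_of M) ({z} \<inter> mspace M)"
    using closedin_Hausdorff_singleton[of "mtopology_of M" z]
      Metric_space.Hausdorff_space_mtopology[OF Metric_space_mspace_mdist[of M]]
    by (cases "z \<in> mspace M")
      (simp_all add: mtopology_of_def Metric_space.topspace_mtopology[OF Metric_space_mspace_mdist])
  then have "openin (mtopology_of M) (mspace M - ({z} \<inter> mspace M))"
    by (simp add: closedin_def)
  from sets.compl_sets[OF sets_borel_of_metric_openin[OF this]]
  show ?thesis by (simp add: Diff_Diff_Int Int_commute)
qed

lemma measurable_borel_of_metric_continuous:
  fixes f :: "'a \<Rightarrow> 'b::topological_space"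
  assumes "continuous_map (mtopology_of M) euclidean f"
  shows "f \<in> borel_measurable (borel_of_metric M)"
proof (rule borel_measurableI)
  fix S :: "'b set" assume "open S"
  then have "openin (mtopology_of M) {x \<in> topspace (mtopology_of M). f x \<in> S}"
    using assms by (simp add: continuous_map)
  then show "f -` S \<inter> space (borel_of_metric M) \<in> sets (borel_of_metric M)"
    by (auto dest!: sets_borel_of_metric_openin simp: Int_def conj_commute)
qed

lemma measurable_mdist_left:
  assumes "z \<in> mspace M"
  shows "(\<lambda>x. mdist M x z) \<in> borel_measurable (borel_of_metric M)"
proof (rule borel_measurableI_less)
  fix y
  have "openin (mtopology_of M) (mball_of M z y)"
    by (metis Metric_space.openin_mball Metric_space_mspace_mdist mball_of_def mtopology_of_def)
  moreover have "mball_of M z y = {x \<in> space (borel_of_metric M). mdist M x z < y}"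
    using assms by (auto simp: mdist_commute)
  ultimately show "{x \<in> space (borel_of_metric M). mdist M x z < y} \<in> sets (borel_of_metric M)"
    using sets_borel_of_metric_openin by metis
qed

text \<open>Separability enters because measurability is asked for the product of the Borel
  algebras. Each strict sublevel set is a countable union, over intermediate points \<open>z\<close>
  of a dense set and rational splittings \<open>q\<close> of \<open>r\<close>, of sets cut out by
  one condition on each coordinate.\<close>

lemma measurable_mdist:
  assumes "separable_space (mtopology_of M)"
  shows "(\<lambda>(x, y). mdist M x y) \<in> borel_measurable (borel_of_metric M \<Otimes>\<^sub>M borel_of_metric M)"
    (is "_ \<in> borel_measurable ?BB")
proof (rule borel_measurableI_less)
  fix r :: real
  obtain C where C: "countable C" "C \<subseteq> mspace M" "mtopology_of M closure_of C = mspace M"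
    using assms by (auto simp: separable_space_def)
  have dense: "\<exists>z\<in>C. mdist M x z < e" if "x \<in> mspace M" "e > 0" for x e
  proof -
    have "x \<in> mtopology_of M closure_of C" using C that by simp
    then have "\<exists>y\<in>C. y \<in> mball_of M x e"
      using that Metric_space.metric_closure_of[OF Metric_space_mspace_mdist, of M C]
      by (auto simp: mtopology_of_def mball_of_def)
    then show ?thesis by auto
  qed
  have split: "(mdist M x y < r) \<longleftrightarrow> (\<exists>z\<in>C. \<exists>q\<in>\<rat>. mdist M x z < q \<and> mdist M y z < r - q)"
    if xy: "x \<in> mspace M" "y \<in> mspace M" for x y
  proof
    assume "mdist M x y < r"
    \<comment> \<open>Half of the slack is the right radius: the distance to \<open>z\<close> is
      counted twice, once for \<open>x\<close> and once through the triangle inequality for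
      \<open>y\<close>.\<close>
    then obtain z where z: "z \<in> C" "mdist M x z < (r - mdist M x y) / 2"
      using dense[OF xy(1), of "(r - mdist M x y) / 2"] by auto
    have "mdist M y z \<le> mdist M x y + mdist M x z"
      using mdist_triangle[of y M x z] z C xy by (auto simp: mdist_commute)
    then have "mdist M x z < r - mdist M y z" using z by simp
    then obtain q where "q \<in> \<rat>" "mdist M x z < q" "q < r - mdist M y z"
      using Rats_dense_in_real by blast
    then show "\<exists>z\<in>C. \<exists>q\<in>\<rat>. mdist M x z < q \<and> mdist M y z < r - q"
      using z by (intro bexI[of _ z] bexI[of _ q]) auto
  next
    assume "\<exists>z\<in>C. \<exists>q\<in>\<rat>. mdist M x z < q \<and> mdist M y z < r - q"
    then obtain z q where z: "z \<in> C" "mdist M x z < q" "mdist M y z < r - q" by auto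
    then show "mdist M x y < r"
      using mdist_triangle[of x M z y] C xy by (auto simp: mdist_commute)
  qed
  have "{w \<in> space ?BB. (case w of (x, y) \<Rightarrow> mdist M x y) < r} =
      (\<Union>z\<in>C. \<Union>q\<in>\<rat>. {w \<in> space ?BB. mdist M (fst w) z < q \<and> mdist M (snd w) z < r - q})"
    by (auto simp: space_pair_measure split) blast
  also have "\<dots> \<in> sets ?BB"
  proof (intro sets.countable_UN'' C countable_rat)
    fix z q assume "z \<in> C"
    then have [measurable]: "(\<lambda>x. mdist M x z) \<in> borel_measurable (borel_of_metric M)"
      using C by (intro measurable_mdist_left) auto
    show "{w \<in> space ?BB. mdist M (fst w) z < q \<and> mdist M (snd w) z < r - q} \<in> sets ?BB"
      by measurable
  qed
  finally show "{w \<in> space ?BB. (case w of (x, y) \<Rightarrow> mdist M x y) < r} \<in> sets ?BB" .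
qed

section \<open>Convex families of functions on a compact set\<close>

text \<open>Two-function case of a minimax theorem. The pairs dominating some
  \<open>(f k, g k)\<close>, shifted by a margin, form a convex planar set that misses the origin;
  the normal of a separating line lies in the closed first quadrant and, normalised, gives the
  weights.\<close>

lemma convex_pair_positive_combination:
  fixes K :: "'e::real_normed_vector set" and f g :: "'e \<Rightarrow> real"
  assumes "compact K" and f: "convex_on K f" "continuous_on K f"
    and g: "convex_on K g" "continuous_on K g"
    and pos: "\<And>k. k \<in> K \<Longrightarrow> f k > 0 \<or> g k > 0"
  obtains w where "0 \<le> w" "w \<le> 1" "\<And>k. k \<in> K \<Longrightarrow> w * f k + (1 - w) * g k > 0"
proof (cases "K = {}")
  case True
  then show thesis using that[of 0] by simp
next
  case False
  have "continuous_on K (\<lambda>k. max (f k) (g k))" by (intro continuous_intros f g)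
  from continuous_attains_inf[OF \<open>compact K\<close> False this]
  obtain k0 where k0: "k0 \<in> K" "\<And>k. k \<in> K \<Longrightarrow> max (f k0) (g k0) \<le> max (f k) (g k)" by blast
  \<comment> \<open>Half the minimum over \<open>K\<close> of the larger of the two functions. The
    separation below is not strict, and this positive margin restores strictness.\<close>
  define e where "e = max (f k0) (g k0) / 2"
  have e: "e > 0" "\<And>k. k \<in> K \<Longrightarrow> f k > e \<or> g k > e"
  proof -
    show "e > 0" using pos[OF k0(1)] by (auto simp: e_def)
    then show "f k > e \<or> g k > e" if "k \<in> K" for k
      using k0(2)[OF that] unfolding e_def by linarith
  qed
  \<comment> \<open>The image of \<open>(f, g)\<close> need not be convex; its upward closure is,
    and it also controls the signs of the normal.\<close>
  define C where "C = {(u, v). \<exists>k\<in>K. f k - e \<le> u \<and> g k - e \<le> v}"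
  have "convex C"
  proof (rule convexI)
    fix x y :: "real \<times> real" and u v :: real
    assume "x \<in> C" "y \<in> C" and uv: "0 \<le> u" "0 \<le> v" "u + v = 1"
    then obtain k l where kl: "k \<in> K" "l \<in> K" "f k - e \<le> fst x" "g k - e \<le> snd x"
      "f l - e \<le> fst y" "g l - e \<le> snd y"
      by (auto simp: C_def)
    have mem: "u *\<^sub>R k + v *\<^sub>R l \<in> K"
      using f(1) kl uv by (auto simp: convex_on_def convex_def)
    have aux: "h (u *\<^sub>R k + v *\<^sub>R l) - e \<le> u * a + v * b"
      if "convex_on K h" "h k - e \<le> a" "h l - e \<le> b" for h :: "'e \<Rightarrow> real" and a b
    proof -
      have "h (u *\<^sub>R k + v *\<^sub>R l) \<le> u * h k + v * h l"
        using that(1) kl uv by (auto simp: convex_on_def)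
      also have "\<dots> \<le> u * (a + e) + v * (b + e)"
        using that uv by (intro add_mono mult_left_mono) auto
      also have "\<dots> = u * a + v * b + (u + v) * e" by (simp add: algebra_simps)
      finally show ?thesis using uv by simp
    qed
    show "u *\<^sub>R x + v *\<^sub>R y \<in> C"
      using mem aux[OF f(1), of "fst x" "fst y"] aux[OF g(1), of "snd x" "snd y"] kl
      by (auto simp: C_def case_prod_beta)
  qed
  have "0 \<notin> C"
    using e(2) by (force simp: C_def zero_prod_def not_le)
  from separating_hyperplane_set_0[OF \<open>convex C\<close> this]
  obtain a where a: "a \<noteq> 0" "\<And>x. x \<in> C \<Longrightarrow> 0 \<le> inner a x"
    by blast
  obtain a1 a2 where a12: "a = (a1, a2)" by (cases a)
  have ineq: "0 \<le> a1 * u + a2 * v" if "k \<in> K" "f k - e \<le> u" "g k - e \<le> v" for k u v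
    using a(2)[of "(u, v)"] that by (auto simp: a12 C_def)
  \<comment> \<open>To be used along each coordinate direction, in which \<open>C\<close> is
    unbounded above. The witness in the contradiction gives the value
    \<open>c - (\<bar>c\<bar> + 1) < 0\<close>.\<close>
  have pos': "0 \<le> b" if *: "\<And>z. z \<ge> 0 \<Longrightarrow> 0 \<le> c + b * z" for b c :: real
  proof (rule ccontr)
    assume "\<not> 0 \<le> b"
    then have "c + b * ((\<bar>c\<bar> + 1) / (- b)) = c - (\<bar>c\<bar> + 1)" "(\<bar>c\<bar> + 1) / (- b) \<ge> 0"
      by (simp_all add: not_le divide_nonneg_neg divide_le_0_iff)
    then show False using *[of "(\<bar>c\<bar> + 1) / (- b)"] by linarith
  qed
  have "0 \<le> a1"
  proof (rule pos')
    show "0 \<le> (a1 * (f k0 - e) + a2 * (g k0 - e)) + a1 * z" if "z \<ge> 0" for z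
      using ineq[OF k0(1), of "f k0 - e + z" "g k0 - e"] that by (simp add: algebra_simps)
  qed
  moreover have "0 \<le> a2"
  proof (rule pos')
    show "0 \<le> (a1 * (f k0 - e) + a2 * (g k0 - e)) + a2 * z" if "z \<ge> 0" for z
      using ineq[OF k0(1), of "f k0 - e" "g k0 - e + z"] that by (simp add: algebra_simps)
  qed
  ultimately have a_pos: "0 \<le> a1" "0 \<le> a2" "a1 + a2 > 0"
    using a(1) by (auto simp: a12 zero_prod_def)
  show thesis
  proof (rule that[of "a1 / (a1 + a2)"])
    show "0 \<le> a1 / (a1 + a2)" "a1 / (a1 + a2) \<le> 1" using a_pos by auto
    fix k assume "k \<in> K"
    then have "(a1 + a2) * e \<le> a1 * f k + a2 * g k"
      using ineq[of k "f k - e" "g k - e"] by (simp add: algebra_simps)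
    then have "0 < (a1 * f k + a2 * g k) / (a1 + a2)"
      using a_pos e(1) by (smt (verit) divide_pos_pos mult_pos_pos)
    also have "\<dots> = a1 / (a1 + a2) * f k + (1 - a1 / (a1 + a2)) * g k"
    proof -
      have "1 - a1 / (a1 + a2) = a2 / (a1 + a2)" using a_pos by (simp add: field_simps)
      then show ?thesis by (simp add: add_divide_distrib)
    qed
    finally show "a1 / (a1 + a2) * f k + (1 - a1 / (a1 + a2)) * g k > 0" .
  qed
qed

lemma convex_on_lower_level_set:
  assumes "convex_on S f"
  shows "convex {x \<in> S. f x \<le> r}"
proof (rule convexI)
  fix x y and u v :: real
  assume *: "x \<in> {x \<in> S. f x \<le> r}" "y \<in> {x \<in> S. f x \<le> r}" "0 \<le> u" "0 \<le> v" "u + v = 1"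
  then have "f (u *\<^sub>R x + v *\<^sub>R y) \<le> max (f x) (f y)"
    by (intro convex_lower[OF assms]) auto
  moreover have "convex S" using assms by (simp add: convex_on_def)
  ultimately show "u *\<^sub>R x + v *\<^sub>R y \<in> {x \<in> S. f x \<le> r}"
    using * convexD[of S x y u v] by auto
qed

text \<open>Interchange of quantifiers: compactness leaves finitely many functions, and these are
  eliminated one at a time by merging each with a witness for the set where it fails.\<close>

lemma convex_family_uniformly_positive:
  fixes K :: "'e::real_normed_vector set" and A :: "('e \<Rightarrow> real) set"
  assumes K: "compact K" "convex K"
    and "A \<noteq> {}"
    and mix: "\<And>f g w. f \<in> A \<Longrightarrow> g \<in> A \<Longrightarrow> 0 \<le> w \<Longrightarrow> w \<le> 1 \<Longrightarrow> (\<lambda>k. w * f k + (1 - w) * g k) \<in> A"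
    and cvx: "\<And>f. f \<in> A \<Longrightarrow> convex_on K f"
    and cont: "\<And>f. f \<in> A \<Longrightarrow> continuous_on UNIV f"
    and pos: "\<And>k. k \<in> K \<Longrightarrow> \<exists>f\<in>A. f k > 0"
  obtains f where "f \<in> A" "\<And>k. k \<in> K \<Longrightarrow> f k > 0"
proof -
  have "open {k. f k > 0}" if "f \<in> A" for f
    using cont[OF that] by (intro open_Collect_less) auto
  then obtain S where S: "S \<subseteq> A" "finite S" "K \<subseteq> (\<Union>f\<in>S. {k. f k > 0})"
  proof (rule compactE_image[OF K(1)])
    show "K \<subseteq> (\<Union>f\<in>A. {k. f k > 0})" using pos by fastforce
  qed
  \<comment> \<open>The set \<open>L\<close> must vary, since the induction hypothesis is applied to
    a smaller compact convex set.\<close>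
  have "\<exists>f\<in>A. \<forall>k\<in>L. f k > 0"
    if "finite S" "S \<subseteq> A" "compact L" "convex L" "L \<subseteq> K" "L \<subseteq> (\<Union>f\<in>S. {k. f k > 0})" for L
    using that
  proof (induction S arbitrary: L rule: finite_induct)
    case empty
    then show ?case using \<open>A \<noteq> {}\<close> by auto
  next
    case (insert g S)
    then have g: "g \<in> A" by simp
    have cv: "convex_on L f" and ct: "continuous_on L f" if "f \<in> A" for f
      using convex_on_subset[OF cvx[OF that]] continuous_on_subset[OF cont[OF that]] insert.prems by auto
    \<comment> \<open>Where \<open>g\<close> fails to be positive. Convexity of \<open>g\<close>
      keeps this set convex, continuity keeps it compact, and the remaining functions of
      \<open>S\<close> cover it.\<close>
    define L' where "L' = L \<inter> {k. g k \<le> 0}"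
    have "compact L'"
      unfolding L'_def using insert.prems cont[OF g]
      by (intro compact_Int_closed closed_Collect_le) auto
    moreover have "convex L'"
      using convex_on_lower_level_set[OF cv[OF g], of 0] by (simp add: L'_def Int_def)
    moreover have "L' \<subseteq> (\<Union>f\<in>S. {k. f k > 0})"
      using insert.prems by (fastforce simp: L'_def)
    ultimately obtain f where f: "f \<in> A" "\<forall>k\<in>L'. f k > 0"
      using insert.IH[of L'] insert.prems by (auto simp: L'_def)
    have "f k > 0 \<or> g k > 0" if "k \<in> L" for k
      using f(2) that by (auto simp: L'_def not_le[symmetric])
    then obtain w where "0 \<le> w" "w \<le> 1" "\<And>k. k \<in> L \<Longrightarrow> w * f k + (1 - w) * g k > 0"
      using convex_pair_positive_combination[OF \<open>compact L\<close> cv[OF f(1)] ct[OF f(1)] cv[OF g] ct[OF g]]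
      by blast
    then show ?case using mix[OF f(1) g] by (intro bexI[of _ "\<lambda>k. w * f k + (1 - w) * g k"]) auto
  qed
  from this[OF S(2,1) K subset_refl S(3)] show thesis using that by blast
qed

section \<open>Weak duality\<close>

lemma sets_empirical [simp]: "sets (empirical M \<xi>s) = sets (borel_of_metric M)"
proof -
  have "sets (borel_of_metric M) \<subseteq> Pow (mspace M)"
    using sets.space_closed[of "borel_of_metric M"] by simp
  then show ?thesis
    using sets.sigma_sets_eq[of "borel_of_metric M"] by (simp add: empirical_def)
qed

text \<open>Sampling an index uniformly turns the average of Dirac measures into an image measure;
  coinciding samples keep their multiplicity. Integrals and total mass then follow by change of
  variables.\<close>

lemma empirical_eq_distr:
  fixes \<xi>s :: "'k::finite \<Rightarrow> 'a"
  assumes "\<And>i. \<xi>s i \<in> mspace M"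
  shows "empirical M \<xi>s = distr (measure_pmf (pmf_of_set UNIV)) (borel_of_metric M) \<xi>s"
proof (rule measure_eqI)
  fix A assume "A \<in> sets (empirical M \<xi>s)"
  then have A: "A \<in> sets (borel_of_metric M)" by simp
  have "emeasure (distr (measure_pmf (pmf_of_set UNIV)) (borel_of_metric M) \<xi>s) A
      = (\<integral>\<^sup>+ i. indicator (\<xi>s -` A) i \<partial>measure_pmf (pmf_of_set UNIV))"
    using A assms by (subst emeasure_distr) auto
  also have "\<dots> = (\<Sum>i\<in>UNIV. indicator (\<xi>s -` A) i) / of_nat CARD('k)"
    by (subst nn_integral_pmf_of_set) auto
  also have "\<dots> = emeasure (empirical M \<xi>s) A"
    using A by (subst emeasure_empirical) (auto intro!: arg_cong2[where f="(/)"] sum.cong simp: indicator_def)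
  finally show "emeasure (empirical M \<xi>s) A
      = emeasure (distr (measure_pmf (pmf_of_set UNIV)) (borel_of_metric M) \<xi>s) A" ..
qed simp

lemma nn_integral_empirical:
  fixes \<xi>s :: "'k::finite \<Rightarrow> 'a"
  assumes "\<And>i. \<xi>s i \<in> mspace M" "f \<in> borel_measurable (borel_of_metric M)"
  shows "(\<integral>\<^sup>+ x. f x \<partial>empirical M \<xi>s) = (\<Sum>i\<in>UNIV. f (\<xi>s i)) / of_nat CARD('k)"
  unfolding empirical_eq_distr[of \<xi>s M, OF assms(1)]
  using assms by (subst nn_integral_distr) (auto simp: nn_integral_pmf_of_set)

lemma prob_space_empirical:
  fixes \<xi>s :: "'k::finite \<Rightarrow> 'a"
  assumes "\<And>i. \<xi>s i \<in> mspace M"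
  shows "prob_space (empirical M \<xi>s)"
  unfolding empirical_eq_distr[of \<xi>s M, OF assms]
  using assms by (intro prob_space.prob_space_distr) (auto simp: measure_pmf.prob_space_axioms)

lemma measurable_coupling:
  assumes "\<gamma> \<in> couplings M \<mu> \<nu>" "f \<in> measurable (borel_of_metric M \<Otimes>\<^sub>M borel_of_metric M) N"
  shows "f \<in> measurable \<gamma> N"
  using assms by (subst measurable_cong_sets[of \<gamma> "borel_of_metric M \<Otimes>\<^sub>M borel_of_metric M" N N])
    (auto simp: couplings_def)

text \<open>Almost surely the second coordinate of the coupling is a sample, so the pointwise bound
  \<open>le\<close> applies. On integration the marginals produce the integral over \<open>P\<close>
  and the average over the samples.\<close>

lemma coupling_bound:
  fixes \<xi>s :: "'k::finite \<Rightarrow> 'a" and s :: "'k \<Rightarrow> real"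
  assumes sep: "separable_space (mtopology_of M)" and \<xi>s: "\<And>i. \<xi>s i \<in> mspace M"
    and \<gamma>: "\<gamma> \<in> couplings M P (empirical M \<xi>s)"
    and f: "f \<in> borel_measurable (borel_of_metric M)"
    and "l \<ge> 0" and s: "\<And>i. s i \<ge> 0"
    and le: "\<And>i \<xi>. \<xi> \<in> mspace M \<Longrightarrow> f \<xi> \<le> s i + l * mdist M \<xi> (\<xi>s i) powr p"
  shows "(\<integral>\<^sup>+ \<xi>. ennreal (f \<xi>) \<partial>P) \<le> ennreal ((\<Sum>i\<in>UNIV. s i) / real CARD('k)) +
      ennreal l * (\<integral>\<^sup>+ (\<xi>, \<omega>). ennreal (mdist M \<xi> \<omega> powr p) \<partial>\<gamma>)"
proof -
  note meas = measurable_coupling[OF \<gamma>]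
  have P: "P = distr \<gamma> (borel_of_metric M) fst" and E: "empirical M \<xi>s = distr \<gamma> (borel_of_metric M) snd"
    using \<gamma> by (auto simp: couplings_def)
  have [measurable]: "fst \<in> measurable \<gamma> (borel_of_metric M)" "snd \<in> measurable \<gamma> (borel_of_metric M)"
    by (auto intro!: meas)
  have dist_meas: "(\<lambda>z. mdist M (fst z) (snd z)) \<in> borel_measurable \<gamma>"
    using meas[OF measurable_mdist[OF sep]] by (simp add: case_prod_beta')
  have [measurable]: "{z} \<inter> mspace M \<in> sets (borel_of_metric M)" for z
    by (rule sets_borel_of_metric_singleton)
  note f[measurable]
  \<comment> \<open>samples may coincide, so the bound as a function of the sample takes the smallest \<open>s i\<close>\<close>
  define m where "m z = Min (s ` {i. \<xi>s i = z})" for z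
  define S where "S \<omega> = (\<Sum>z\<in>range \<xi>s. m z * indicator ({z} \<inter> mspace M) \<omega>)" for \<omega>
  have [measurable]: "S \<in> borel_measurable (borel_of_metric M)"
    unfolding S_def by measurable
  have m: "\<exists>j. \<xi>s j = \<xi>s i \<and> m (\<xi>s i) = s j" "m (\<xi>s i) \<le> s i" for i
  proof -
    have "m (\<xi>s i) \<in> s ` {j. \<xi>s j = \<xi>s i}" unfolding m_def by (rule Min_in) auto
    then show "\<exists>j. \<xi>s j = \<xi>s i \<and> m (\<xi>s i) = s j" by auto
    show "m (\<xi>s i) \<le> s i" unfolding m_def by (rule Min_le) auto
  qed
  have S: "S (\<xi>s i) = m (\<xi>s i)" for i
  proof -
    have "S (\<xi>s i) = (\<Sum>z\<in>range \<xi>s. if z = \<xi>s i then m z else 0)"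
      unfolding S_def using \<xi>s by (intro sum.cong) (auto simp: indicator_def)
    then show ?thesis by simp
  qed
  have "AE \<omega> in empirical M \<xi>s. \<omega> \<in> range \<xi>s"
  proof -
    have "{\<omega> \<in> space (borel_of_metric M). \<omega> \<in> range \<xi>s} = (\<Union>z\<in>range \<xi>s. {z} \<inter> mspace M)"
      by auto
    also have "\<dots> \<in> sets (borel_of_metric M)" by (intro sets.finite_UN) auto
    finally show ?thesis
      using \<xi>s by (subst empirical_eq_distr) (auto simp: AE_distr_iff)
  qed
  then have "AE z in \<gamma>. snd z \<in> range \<xi>s"
    unfolding E by (rule AE_distrD[rotated]) measurable
  moreover have "AE z in \<gamma>. z \<in> space (borel_of_metric M \<Otimes>\<^sub>M borel_of_metric M)"
    using \<gamma> sets_eq_imp_space_eq[of \<gamma> "borel_of_metric M \<Otimes>\<^sub>M borel_of_metric M"]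
    by (intro AE_I2) (auto simp: couplings_def)
  ultimately have AE: "AE z in \<gamma>. ennreal (f (fst z)) \<le>
      ennreal (S (snd z)) + ennreal l * ennreal (case z of (\<xi>, \<omega>) \<Rightarrow> mdist M \<xi> \<omega> powr p)"
  proof eventually_elim
    case (elim z)
    then obtain i where i: "snd z = \<xi>s i" and "fst z \<in> mspace M"
      by (auto simp: space_pair_measure)
    \<comment> \<open>The bound is applied at an index \<open>j\<close> attaining the minimum in
      \<open>m\<close>; it belongs to the same sample point, so the distance is unchanged.\<close>
    moreover obtain j where j: "\<xi>s j = \<xi>s i" "m (\<xi>s i) = s j" using m by blast
    ultimately have "f (fst z) \<le> S (snd z) + l * mdist M (fst z) (snd z) powr p"
      using le[of "fst z" j] S by simp
    moreover have "S (snd z) \<ge> 0" using i j S s by simp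
    ultimately show ?case
      using \<open>l \<ge> 0\<close> by (auto simp: ennreal_mult'[symmetric] ennreal_plus[symmetric] case_prod_beta
        simp del: ennreal_plus intro!: ennreal_leI)
  qed
  have "(\<integral>\<^sup>+ \<xi>. ennreal (f \<xi>) \<partial>P) = (\<integral>\<^sup>+ z. ennreal (f (fst z)) \<partial>\<gamma>)"
    unfolding P by (subst nn_integral_distr) auto
  also have "\<dots> \<le> (\<integral>\<^sup>+ z. ennreal (S (snd z)) +
      ennreal l * ennreal (case z of (\<xi>, \<omega>) \<Rightarrow> mdist M \<xi> \<omega> powr p) \<partial>\<gamma>)"
    by (rule nn_integral_mono_AE) (rule AE)
  also have "\<dots> = (\<integral>\<^sup>+ z. ennreal (S (snd z)) \<partial>\<gamma>) +
      ennreal l * (\<integral>\<^sup>+ z. ennreal (case z of (\<xi>, \<omega>) \<Rightarrow> mdist M \<xi> \<omega> powr p) \<partial>\<gamma>)"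
  proof -
    have "(\<lambda>z. ennreal (case z of (\<xi>, \<omega>) \<Rightarrow> mdist M \<xi> \<omega> powr p)) \<in> borel_measurable \<gamma>"
      unfolding case_prod_beta
      by (intro measurable_compose[OF _ measurable_ennreal] powr_real_measurable dist_meas measurable_const) auto
    then show ?thesis by (subst nn_integral_add) (auto simp: nn_integral_cmult)
  qed
  also have "(\<integral>\<^sup>+ z. ennreal (S (snd z)) \<partial>\<gamma>) = (\<integral>\<^sup>+ \<omega>. ennreal (S \<omega>) \<partial>empirical M \<xi>s)"
    unfolding E by (subst nn_integral_distr) auto
  also have "\<dots> = (\<Sum>i\<in>UNIV. ennreal (m (\<xi>s i))) / of_nat CARD('k)"
    using \<xi>s by (subst nn_integral_empirical) (auto simp: S)
  also have "\<dots> \<le> (\<Sum>i\<in>UNIV. ennreal (s i)) / of_nat CARD('k)"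
    by (intro divide_right_mono_ennreal sum_mono ennreal_leI m)
  also have "\<dots> = ennreal ((\<Sum>i\<in>UNIV. s i) / real CARD('k))"
    using s by (subst sum_ennreal) (auto simp: divide_ennreal sum_nonneg ennreal_of_nat_eq_real_of_nat)
  finally show ?thesis by (simp add: case_prod_beta')
qed

text \<open>The product coupling already has finite cost, by the moment condition on
  \<open>P\<close> and because the other marginal is finitely supported. This keeps
  \<open>enn2real\<close> in \<open>wasserstein\<close> from sending an infinite cost to 0.\<close>

lemma coupling_cost_finite:
  fixes \<xi>s :: "'k::finite \<Rightarrow> 'a"
  assumes sep: "separable_space (mtopology_of M)" and \<xi>s: "\<And>i. \<xi>s i \<in> mspace M" and "p \<ge> 0"
    and P: "P \<in> prob_measures_moment p M"
  shows "(INF \<gamma>\<in>couplings M P (empirical M \<xi>s). \<integral>\<^sup>+ (\<xi>, \<omega>). ennreal (mdist M \<xi> \<omega> powr p) \<partial>\<gamma>) < \<infinity>"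
proof -
  obtain \<xi>0 where P': "prob_space P" "sets P = sets (borel_of_metric M)" "\<xi>0 \<in> mspace M"
    and fin: "(\<integral>\<^sup>+ \<xi>. ennreal (mdist M \<xi> \<xi>0 powr p) \<partial>P) < \<infinity>"
    using P by (auto simp: prob_measures_moment_def)
  let ?E = "empirical M \<xi>s"
  have spP: "space P = mspace M" using sets_eq_imp_space_eq[OF P'(2)] by simp
  interpret P: prob_space P by fact
  interpret E: prob_space ?E using \<xi>s by (rule prob_space_empirical)
  interpret PE: pair_prob_space P ?E ..
  have sets_PE: "sets (P \<Otimes>\<^sub>M ?E) = sets (borel_of_metric M \<Otimes>\<^sub>M borel_of_metric M)"
    using P' by (intro sets_pair_measure_cong) auto
  have "P \<Otimes>\<^sub>M ?E \<in> couplings M P ?E"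
    unfolding couplings_def
  proof (intro CollectI conjI)
    show "prob_space (P \<Otimes>\<^sub>M ?E)" by (rule PE.prob_space_axioms)
    show "distr (P \<Otimes>\<^sub>M ?E) (borel_of_metric M) fst = P"
      using E.distr_pair_fst[of P] P'(2) by (metis distr_cong)
    \<comment> \<open>The second marginal is reduced to a first marginal by exchanging the
      factors.\<close>
    have "distr (P \<Otimes>\<^sub>M ?E) (borel_of_metric M) snd = distr (distr (P \<Otimes>\<^sub>M ?E) (?E \<Otimes>\<^sub>M P) (\<lambda>(x, y). (y, x))) ?E fst"
      by (subst distr_distr) (auto intro!: distr_cong)
    also have "distr (P \<Otimes>\<^sub>M ?E) (?E \<Otimes>\<^sub>M P) (\<lambda>(x, y). (y, x)) = ?E \<Otimes>\<^sub>M P"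
      using pair_sigma_finite.distr_pair_swap[of ?E P] E.sigma_finite_measure_axioms P.sigma_finite_measure_axioms
      by (simp add: pair_sigma_finite_def)
    also have "distr (?E \<Otimes>\<^sub>M P) ?E fst = ?E" by (rule P.distr_pair_fst)
    finally show "distr (P \<Otimes>\<^sub>M ?E) (borel_of_metric M) snd = ?E" .
  qed (rule sets_PE)
  moreover have "(\<integral>\<^sup>+ (\<xi>, \<omega>). ennreal (mdist M \<xi> \<omega> powr p) \<partial>(P \<Otimes>\<^sub>M ?E)) < \<infinity>"
  proof -
    have [measurable]: "(\<lambda>(\<xi>, \<omega>). mdist M \<xi> \<omega>) \<in> borel_measurable (P \<Otimes>\<^sub>M ?E)"
      using measurable_mdist[OF sep] by (subst measurable_cong_sets[OF sets_PE refl])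
    have dist_meas: "(\<lambda>\<xi>. mdist M \<xi> z) \<in> borel_measurable (borel_of_metric M)" if "z \<in> mspace M" for z
      using that by (rule measurable_mdist_left)
    have meas_P: "(\<lambda>\<xi>. mdist M \<xi> z) \<in> borel_measurable P" if "z \<in> mspace M" for z
      using dist_meas[OF that] by (subst measurable_cong_sets[OF P'(2) refl])
    have "(\<integral>\<^sup>+ (\<xi>, \<omega>). ennreal (mdist M \<xi> \<omega> powr p) \<partial>(P \<Otimes>\<^sub>M ?E))
        = (\<integral>\<^sup>+ \<xi>. \<integral>\<^sup>+ \<omega>. ennreal (mdist M \<xi> \<omega> powr p) \<partial>?E \<partial>P)"
      by (subst E.nn_integral_fst[symmetric]) (auto simp: case_prod_beta)
    also have "\<dots> = (\<integral>\<^sup>+ \<xi>. (\<Sum>i\<in>UNIV. ennreal (mdist M \<xi> (\<xi>s i) powr p)) / of_nat CARD('k) \<partial>P)"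
    proof (intro nn_integral_cong)
      fix \<xi> assume "\<xi> \<in> space P"
      then have [measurable]: "(\<lambda>\<omega>. mdist M \<xi> \<omega>) \<in> borel_measurable (borel_of_metric M)"
        using dist_meas[of \<xi>] spP by (simp add: mdist_commute)
      show "(\<integral>\<^sup>+ \<omega>. ennreal (mdist M \<xi> \<omega> powr p) \<partial>?E)
          = (\<Sum>i\<in>UNIV. ennreal (mdist M \<xi> (\<xi>s i) powr p)) / of_nat CARD('k)"
        using \<xi>s by (intro nn_integral_empirical) measurable
    qed
    \<comment> \<open>Only finiteness is wanted, so the division by the number of samples, which is
      at least 1, is dropped.\<close>
    also have "\<dots> \<le> (\<integral>\<^sup>+ \<xi>. (\<Sum>i\<in>UNIV. ennreal (mdist M \<xi> (\<xi>s i) powr p)) \<partial>P)"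
    proof (intro nn_integral_mono divide_le_posI_ennreal)
      fix \<xi>
      have "(1 :: ennreal) \<le> of_nat CARD('k)"
        using of_nat_mono[of 1 "CARD('k)", where 'a = ennreal] by (simp add: Suc_le_eq)
      from mult_right_mono[OF this, of "\<Sum>i\<in>UNIV. ennreal (mdist M \<xi> (\<xi>s i) powr p)"]
      show "(\<Sum>i\<in>UNIV. ennreal (mdist M \<xi> (\<xi>s i) powr p))
          \<le> of_nat CARD('k) * (\<Sum>i\<in>UNIV. ennreal (mdist M \<xi> (\<xi>s i) powr p))"
        by simp
    qed (auto simp: zero_less_card_finite)
    also have "\<dots> = (\<Sum>i\<in>UNIV. \<integral>\<^sup>+ \<xi>. ennreal (mdist M \<xi> (\<xi>s i) powr p) \<partial>P)"
      by (intro nn_integral_sum measurable_compose[OF _ measurable_ennreal] powr_real_measurable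
          meas_P \<xi>s measurable_const) auto
    also have "\<dots> < \<infinity>"
    proof -
      have "(\<integral>\<^sup>+ \<xi>. ennreal (mdist M \<xi> (\<xi>s i) powr p) \<partial>P) < \<infinity>" for i
      proof -
        define D where "D = mdist M \<xi>0 (\<xi>s i)"
        have "(\<integral>\<^sup>+ \<xi>. ennreal (mdist M \<xi> (\<xi>s i) powr p) \<partial>P)
            \<le> (\<integral>\<^sup>+ \<xi>. ennreal (2 powr p) * ennreal (mdist M \<xi> \<xi>0 powr p) + ennreal ((2 * D) powr p) \<partial>P)"
        proof (intro nn_integral_mono)
          fix \<xi> assume "\<xi> \<in> space P"
          then have "mdist M \<xi> (\<xi>s i) \<le> mdist M \<xi> \<xi>0 + D"
            unfolding D_def using \<xi>s P' spP by (intro mdist_triangle) auto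
          \<comment> \<open>The detour through the maximum splits the power: the \<open>p\<close>-th
            power of a maximum is at most the sum of the two powers.\<close>
          then have "mdist M \<xi> (\<xi>s i) \<le> 2 * max (mdist M \<xi> \<xi>0) D" by simp
          then have "mdist M \<xi> (\<xi>s i) powr p \<le> (2 * max (mdist M \<xi> \<xi>0) D) powr p"
            using \<open>p \<ge> 0\<close> by (intro powr_mono2) auto
          also have "\<dots> \<le> (2 * mdist M \<xi> \<xi>0) powr p + (2 * D) powr p"
            by (auto simp: max_def)
          also have "\<dots> = 2 powr p * mdist M \<xi> \<xi>0 powr p + (2 * D) powr p"
            by (simp add: powr_mult)
          finally show "ennreal (mdist M \<xi> (\<xi>s i) powr p)
              \<le> ennreal (2 powr p) * ennreal (mdist M \<xi> \<xi>0 powr p) + ennreal ((2 * D) powr p)"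
            by (simp add: ennreal_mult'[symmetric] ennreal_plus[symmetric] ennreal_leI del: ennreal_plus)
        qed
        also have "\<dots> = ennreal (2 powr p) * (\<integral>\<^sup>+ \<xi>. ennreal (mdist M \<xi> \<xi>0 powr p) \<partial>P) + ennreal ((2 * D) powr p)"
          using meas_P[OF P'(3)] by (subst nn_integral_add) (auto simp: nn_integral_cmult P.emeasure_space_1)
        also have "\<dots> < \<infinity>" using fin by (simp add: ennreal_mult_less_top)
        finally show ?thesis .
      qed
      then show ?thesis by (simp add: less_top)
    qed
    finally show ?thesis .
  qed
  ultimately show ?thesis by (rule le_less_trans[OF INF_lower])
qed

text \<open>Undoes the \<open>p\<close>-th root in \<open>wasserstein\<close>; finiteness of the
  cost makes \<open>enn2real\<close> faithful here.\<close>

lemma wasserstein_ball_cost_le: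
  fixes \<xi>s :: "'k::finite \<Rightarrow> 'a"
  assumes "separable_space (mtopology_of M)" "\<And>i. \<xi>s i \<in> mspace M" "p \<ge> 1" "\<theta> > 0"
    and P: "P \<in> wasserstein_ball p \<theta> M \<xi>s"
  shows "(INF \<gamma>\<in>couplings M P (empirical M \<xi>s). \<integral>\<^sup>+ (\<xi>, \<omega>). ennreal (mdist M \<xi> \<omega> powr p) \<partial>\<gamma>)
    \<le> ennreal (\<theta> powr p)" (is "?I \<le> _")
proof -
  have "?I < \<infinity>"
    using assms by (intro coupling_cost_finite) (auto simp: wasserstein_ball_def)
  then have I: "?I = ennreal (enn2real ?I)" by simp
  have "enn2real ?I powr (1 / p) \<le> \<theta>"
    using P by (simp add: wasserstein_ball_def wasserstein_def)
  then have "(enn2real ?I powr (1 / p)) powr p \<le> \<theta> powr p"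
    using assms by (intro powr_mono2) auto
  then have "enn2real ?I \<le> \<theta> powr p"
    using \<open>p \<ge> 1\<close> by (simp add: powr_powr)
  then show ?thesis using I ennreal_leI by metis
qed

text \<open>For every \<open>e > 0\<close> some coupling costs less than
  \<open>\<theta> powr p + e\<close>; \<open>coupling_bound\<close> is applied to it and
  \<open>e\<close> tends to 0. Here \<open>l\<close> is the multiplier of the cost constraint and
  \<open>s\<close> bounds the penalised values of \<open>f\<close>.\<close>

theorem wasserstein_weak_duality:
  fixes \<xi>s :: "'k::finite \<Rightarrow> 'a" and s :: "'k \<Rightarrow> real"
  assumes sep: "separable_space (mtopology_of M)" and \<xi>s: "\<And>i. \<xi>s i \<in> mspace M"
    and p: "p \<ge> 1" and \<theta>: "\<theta> > 0"
    and P: "P \<in> wasserstein_ball p \<theta> M \<xi>s"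
    and f: "f \<in> borel_measurable (borel_of_metric M)" "\<And>\<xi>. \<xi> \<in> mspace M \<Longrightarrow> f \<xi> \<ge> 0"
    and l: "l \<ge> 0" and s: "\<And>i. s i \<ge> 0"
    and le: "\<And>i \<xi>. \<xi> \<in> mspace M \<Longrightarrow> f \<xi> \<le> s i + l * mdist M \<xi> (\<xi>s i) powr p"
  shows "(\<integral>\<xi>. f \<xi> \<partial>P) \<le> l * \<theta> powr p + (\<Sum>i\<in>UNIV. s i) / real CARD('k)"
proof -
  have setsP: "sets P = sets (borel_of_metric M)"
    using P by (auto simp: wasserstein_ball_def prob_measures_moment_def)
  define a where "a = (\<Sum>i\<in>UNIV. s i) / real CARD('k)"
  have a: "a \<ge> 0" unfolding a_def using s by (intro divide_nonneg_nonneg sum_nonneg) auto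
  have bound: "(\<integral>\<^sup>+ \<xi>. ennreal (f \<xi>) \<partial>P) \<le> ennreal (l * (\<theta> powr p + e) + a)" if "e > 0" for e
  proof -
    have "(INF \<gamma>\<in>couplings M P (empirical M \<xi>s). \<integral>\<^sup>+ (\<xi>, \<omega>). ennreal (mdist M \<xi> \<omega> powr p) \<partial>\<gamma>)
        < ennreal (\<theta> powr p + e)"
      using that by (intro le_less_trans[OF wasserstein_ball_cost_le[OF sep \<xi>s p \<theta> P]] ennreal_lessI)
        (auto intro: add_nonneg_pos)
    then obtain \<gamma> where \<gamma>: "\<gamma> \<in> couplings M P (empirical M \<xi>s)"
      "(\<integral>\<^sup>+ (\<xi>, \<omega>). ennreal (mdist M \<xi> \<omega> powr p) \<partial>\<gamma>) < ennreal (\<theta> powr p + e)"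
      by (auto simp: INF_less_iff)
    have "(\<integral>\<^sup>+ \<xi>. ennreal (f \<xi>) \<partial>P) \<le> ennreal a +
        ennreal l * (\<integral>\<^sup>+ (\<xi>, \<omega>). ennreal (mdist M \<xi> \<omega> powr p) \<partial>\<gamma>)"
      unfolding a_def by (rule coupling_bound[OF sep \<xi>s \<gamma>(1) f(1) l s le])
    also have "\<dots> \<le> ennreal a + ennreal l * ennreal (\<theta> powr p + e)"
      using \<gamma>(2) by (intro add_left_mono mult_left_mono) auto
    also have "\<dots> = ennreal (l * (\<theta> powr p + e) + a)"
      using l a that by (simp add: ennreal_mult[symmetric] ennreal_plus[symmetric] add.commute
          add_nonneg_nonneg del: ennreal_plus)
    finally show ?thesis .
  qed
  have nn: "(\<integral>\<xi>. f \<xi> \<partial>P) = enn2real (\<integral>\<^sup>+ \<xi>. ennreal (f \<xi>) \<partial>P)"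
    using f setsP sets_eq_imp_space_eq[OF setsP]
    by (intro integral_eq_nn_integral AE_I2) (auto simp: measurable_cong_sets[OF setsP refl])
  have "(\<integral>\<xi>. f \<xi> \<partial>P) \<le> (l * \<theta> powr p + a) + e" if "e > 0" for e
  proof -
    \<comment> \<open>The excess cost enters with factor \<open>l\<close>; dividing by
      \<open>l + 1\<close> instead of \<open>l\<close> covers \<open>l = 0\<close>.\<close>
    define d where "d = e / (l + 1)"
    have d: "d > 0" "l * d \<le> e" using l that by (auto simp: d_def field_simps)
    have "(\<integral>\<xi>. f \<xi> \<partial>P) \<le> l * (\<theta> powr p + d) + a"
      unfolding nn using bound[OF d(1)] l a d
      by (intro enn2real_leI) (auto intro!: add_nonneg_nonneg mult_nonneg_nonneg)
    then show ?thesis using d(2) by (simp add: algebra_simps)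
  qed
  then show ?thesis unfolding a_def by (rule field_le_epsilon)
qed

section \<open>Strong duality\<close>

text \<open>A plan pairs sample indices, not sample points, with destinations, so equal samples can
  be moved independently. Finite support makes every real function integrable.\<close>

definition transport_plans :: "'a metric \<Rightarrow> ('k::finite \<times> 'a) pmf set" where
  "transport_plans M =
     {Q. finite (set_pmf Q) \<and> snd ` set_pmf Q \<subseteq> mspace M \<and> map_pmf fst Q = pmf_of_set UNIV}"

text \<open>Toss a coin with bias \<open>w\<close>, then draw from the plan it selects. The mixture
  is described by its expectations, which are all that the Lagrangian depends on.\<close>

lemma transport_plans_mix:
  assumes "Q1 \<in> transport_plans M" "Q2 \<in> transport_plans M" "0 \<le> w" "w \<le> 1"
  obtains Q where "Q \<in> transport_plans M"
    "\<And>f :: _ \<Rightarrow> real. measure_pmf.expectation Q f =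
        w * measure_pmf.expectation Q1 f + (1 - w) * measure_pmf.expectation Q2 f"
proof
  define R where "R b = (if b then Q1 else Q2)" for b :: bool
  define Q where "Q = bind_pmf (bernoulli_pmf w) R"
  have sub: "set_pmf Q \<subseteq> set_pmf Q1 \<union> set_pmf Q2"
    by (auto simp: Q_def R_def split: if_splits)
  have fin: "finite (set_pmf Q1 \<union> set_pmf Q2)" using assms by (simp add: transport_plans_def)
  have "map_pmf fst (R b) = pmf_of_set UNIV" for b
    using assms by (simp add: R_def transport_plans_def)
  then have "map_pmf fst Q = pmf_of_set UNIV"
    by (simp add: Q_def map_bind_pmf)
  then show "Q \<in> transport_plans M"
    using sub finite_subset[OF sub fin] assms unfolding transport_plans_def by blast
  fix f :: "_ \<Rightarrow> real"
  have pmf_Q: "pmf Q z = w * pmf Q1 z + (1 - w) * pmf Q2 z" for z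
    using assms by (simp add: Q_def R_def pmf_bind mult.commute)
  \<comment> \<open>All three expectations become sums over one common finite set and can be
    compared termwise.\<close>
  have "measure_pmf.expectation Q' f = (\<Sum>z\<in>set_pmf Q1 \<union> set_pmf Q2. f z * pmf Q' z)"
    if "set_pmf Q' \<subseteq> set_pmf Q1 \<union> set_pmf Q2" for Q'
    using that fin by (intro integral_measure_pmf_real) auto
  from this[OF sub] this[of Q1] this[of Q2]
  show "measure_pmf.expectation Q f =
        w * measure_pmf.expectation Q1 f + (1 - w) * measure_pmf.expectation Q2 f"
    by (simp add: pmf_Q sum_distrib_left sum.distrib[symmetric] algebra_simps)
qed

text \<open>The law of the destination is the required measure; the joint law of destination and
  sample is a coupling whose cost is that of the plan.\<close>

lemma transport_plan_in_wasserstein_ball: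
  fixes \<xi>s :: "'k::finite \<Rightarrow> 'a"
  assumes sep: "separable_space (mtopology_of M)" and \<xi>s: "\<And>i. \<xi>s i \<in> mspace M"
    and p: "p \<ge> 1" and \<theta>: "\<theta> > 0"
    and Q: "Q \<in> transport_plans M"
    and cost: "measure_pmf.expectation Q (\<lambda>z. mdist M (snd z) (\<xi>s (fst z)) powr p) \<le> \<theta> powr p"
  obtains P where "P \<in> wasserstein_ball p \<theta> M \<xi>s"
    "\<And>f :: 'a \<Rightarrow> real. f \<in> borel_measurable (borel_of_metric M) \<Longrightarrow>
      (\<integral>\<xi>. f \<xi> \<partial>P) = measure_pmf.expectation Q (\<lambda>z. f (snd z))"
proof
  let ?B = "borel_of_metric M"
  \<comment> \<open>a measurable map into \<open>?B\<close> must send all of the type into the carrier\<close>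
  define g where "g z = (if snd z \<in> mspace M then snd z else \<xi>s (fst z))" for z
  have g: "g z \<in> mspace M" for z using \<xi>s by (simp add: g_def)
  have AE_g: "AE z in measure_pmf Q. g z = snd z"
    using Q by (auto simp: AE_measure_pmf_iff g_def transport_plans_def)
  have fin: "finite (set_pmf Q)" using Q by (simp add: transport_plans_def)
  define P where "P = distr (measure_pmf Q) ?B g"
  define \<gamma> where "\<gamma> = distr (measure_pmf Q) (?B \<Otimes>\<^sub>M ?B) (\<lambda>z. (g z, \<xi>s (fst z)))"
  have meas: "g \<in> measurable (measure_pmf Q) ?B"
    "(\<lambda>z. (g z, \<xi>s (fst z))) \<in> measurable (measure_pmf Q) (?B \<Otimes>\<^sub>M ?B)"
    using g \<xi>s by (auto simp: space_pair_measure)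
  have nn_fin: "(\<integral>\<^sup>+ z. ennreal (h z) \<partial>measure_pmf Q) = ennreal (measure_pmf.expectation Q h)"
    if "\<And>z. h z \<ge> 0" for h :: "_ \<Rightarrow> real"
    using that fin by (intro nn_integral_eq_integral integrable_measure_pmf_finite) auto
  have "\<gamma> \<in> couplings M P (empirical M \<xi>s)"
    unfolding couplings_def
  proof (intro CollectI conjI)
    show "prob_space \<gamma>"
      unfolding \<gamma>_def by (intro measure_pmf.prob_space_distr meas)
    show "sets \<gamma> = sets (?B \<Otimes>\<^sub>M ?B)" by (simp add: \<gamma>_def)
    show "distr \<gamma> ?B fst = P"
      unfolding \<gamma>_def P_def using meas by (subst distr_distr) (auto simp: comp_def)
    \<comment> \<open>The sample depends on the index alone, and the index is uniform by the
      definition of a plan.\<close>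
    have "distr \<gamma> ?B snd = distr (measure_pmf Q) ?B (\<lambda>z. \<xi>s (fst z))"
      unfolding \<gamma>_def using meas by (subst distr_distr) (auto simp: comp_def)
    also have "\<dots> = distr (measure_pmf (map_pmf fst Q)) ?B \<xi>s"
      using \<xi>s by (subst map_pmf_rep_eq, subst distr_distr) (auto simp: comp_def)
    also have "\<dots> = empirical M \<xi>s"
      using Q \<xi>s by (simp add: transport_plans_def empirical_eq_distr)
    finally show "distr \<gamma> ?B snd = empirical M \<xi>s" .
  qed
  moreover have "(\<integral>\<^sup>+ (\<xi>, \<omega>). ennreal (mdist M \<xi> \<omega> powr p) \<partial>\<gamma>) \<le> ennreal (\<theta> powr p)"
  proof -
    have [measurable]: "(\<lambda>(\<xi>, \<omega>). mdist M \<xi> \<omega>) \<in> borel_measurable (?B \<Otimes>\<^sub>M ?B)"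
      by (rule measurable_mdist[OF sep])
    have "(\<integral>\<^sup>+ (\<xi>, \<omega>). ennreal (mdist M \<xi> \<omega> powr p) \<partial>\<gamma>)
        = (\<integral>\<^sup>+ z. ennreal (mdist M (g z) (\<xi>s (fst z)) powr p) \<partial>measure_pmf Q)"
      unfolding \<gamma>_def using meas by (subst nn_integral_distr) (auto simp: case_prod_beta)
    also have "\<dots> = (\<integral>\<^sup>+ z. ennreal (mdist M (snd z) (\<xi>s (fst z)) powr p) \<partial>measure_pmf Q)"
      using AE_g by (intro nn_integral_cong_AE) auto
    also have "\<dots> \<le> ennreal (\<theta> powr p)"
      using cost by (subst nn_fin) (auto intro: ennreal_leI)
    finally show ?thesis .
  qed
  ultimately have "(INF \<gamma>\<in>couplings M P (empirical M \<xi>s).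
      \<integral>\<^sup>+ (\<xi>, \<omega>). ennreal (mdist M \<xi> \<omega> powr p) \<partial>\<gamma>) \<le> ennreal (\<theta> powr p)"
    by (rule INF_lower2)
  then have "wasserstein p M P (empirical M \<xi>s) \<le> (\<theta> powr p) powr (1 / p)"
    unfolding wasserstein_def using p by (intro powr_mono2 enn2real_leI) auto
  then have "wasserstein p M P (empirical M \<xi>s) \<le> \<theta>"
    using p \<theta> by (simp add: powr_powr)
  moreover have "P \<in> prob_measures_moment p M"
    unfolding prob_measures_moment_def
  proof (intro CollectI conjI bexI)
    show "prob_space P" unfolding P_def by (intro measure_pmf.prob_space_distr meas)
    \<comment> \<open>Any sample serves as the reference point of the moment condition;
      \<open>undefined\<close> merely names some index.\<close>
    show "\<xi>s undefined \<in> mspace M" by (rule \<xi>s)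
    have [measurable]: "(\<lambda>\<xi>. mdist M \<xi> (\<xi>s undefined)) \<in> borel_measurable ?B"
      by (rule measurable_mdist_left[OF \<xi>s])
    show "(\<integral>\<^sup>+ \<xi>. ennreal (mdist M \<xi> (\<xi>s undefined) powr p) \<partial>P) < \<infinity>"
      unfolding P_def using meas(1) by (subst nn_integral_distr) (auto simp: nn_fin)
  qed (simp add: P_def)
  ultimately show "P \<in> wasserstein_ball p \<theta> M \<xi>s" by (simp add: wasserstein_ball_def)
  fix f :: "'a \<Rightarrow> real" assume "f \<in> borel_measurable ?B"
  then have "(\<integral>\<xi>. f \<xi> \<partial>P) = measure_pmf.expectation Q (\<lambda>z. f (g z))"
    unfolding P_def using meas(1) by (intro integral_distr)
  also have "\<dots> = measure_pmf.expectation Q (\<lambda>z. f (snd z))"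
    using AE_g by (intro integral_cong_AE) auto
  finally show "(\<integral>\<xi>. f \<xi> \<partial>P) = measure_pmf.expectation Q (\<lambda>z. f (snd z))" .
qed

text \<open>Contrapositive form: \<open>gap\<close> says that no multipliers are feasible, and the
  conclusion is one measure that works for all \<open>t\<close>. The infimum has to be strictly
  positive to contradict a supremum that is at most 0.\<close>

theorem wasserstein_strong_duality:
  fixes \<xi>s :: "'k::finite \<Rightarrow> 'a" and f :: "'a \<Rightarrow> real"
  assumes sep: "separable_space (mtopology_of M)" and \<xi>s: "\<And>i. \<xi>s i \<in> mspace M"
    and p: "p \<ge> 1" and \<theta>: "\<theta> > 0" and \<alpha>: "0 < \<alpha>" "\<alpha> < 1"
    and f [measurable]: "f \<in> borel_measurable (borel_of_metric M)"
    and bd: "\<And>\<xi>. \<xi> \<in> mspace M \<Longrightarrow> \<bar>f \<xi>\<bar> \<le> B"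
    and gap: "\<And>l t s. l \<ge> 0 \<Longrightarrow> (\<And>i. s i \<ge> 0) \<Longrightarrow>
      (\<And>i \<xi>. \<xi> \<in> mspace M \<Longrightarrow> f \<xi> + t - l * mdist M \<xi> (\<xi>s i) powr p \<le> s i) \<Longrightarrow>
      t * \<alpha> < l * \<theta> powr p + (\<Sum>i\<in>UNIV. s i) / real CARD('k)"
  obtains P where "P \<in> wasserstein_ball p \<theta> M \<xi>s"
    "0 < (INF t. ereal ((\<integral>\<xi>. max (f \<xi> + t) 0 \<partial>P) - t * \<alpha>))"
proof -
  have "B \<ge> 0" using bd[OF \<xi>s[of undefined]] by linarith
  define T where "T = \<theta> powr p"
  have T: "T > 0" using \<theta> by (simp add: T_def)
  let ?E = measure_pmf.expectation
  define D where "D z = mdist M (snd z) (\<xi>s (fst z)) powr p" for z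
  define \<phi> where "\<phi> Q t = ?E Q (\<lambda>z. max (f (snd z) + t) 0) - t * \<alpha>" for Q :: "('k \<times> 'a) pmf" and t
  \<comment> \<open>The pair \<open>k\<close> consists of the \<open>t\<close> of the inner infimum
    and of the price \<open>snd k\<close> for transport cost in excess of \<open>T\<close>.\<close>
  define L where "L Q k = \<phi> Q (fst k) - snd k * (?E Q D - T)"
    for Q :: "('k \<times> 'a) pmf" and k :: "real \<times> real"
  let ?T = "transport_plans M :: ('k \<times> 'a) pmf set"
  have int: "integrable (measure_pmf Q) h" if "Q \<in> ?T" for Q and h :: "_ \<Rightarrow> real"
    using that by (intro integrable_measure_pmf_finite) (simp add: transport_plans_def)
  have graph_plan: "map_pmf (\<lambda>i. (i, h i)) (pmf_of_set UNIV) \<in> ?T" if "\<And>i. h i \<in> mspace M" for h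
    using that by (auto simp: transport_plans_def pmf.map_comp comp_def)
  have E_graph: "?E (map_pmf (\<lambda>i. (i, h i)) (pmf_of_set UNIV)) v
      = (\<Sum>i\<in>UNIV. v (i, h i)) / real CARD('k)" for h :: "'k \<Rightarrow> 'a" and v :: "'k \<times> 'a \<Rightarrow> real"
    by (simp add: integral_pmf_of_set)
  define Q0 :: "('k \<times> 'a) pmf" where "Q0 = map_pmf (\<lambda>i. (i, \<xi>s i)) (pmf_of_set UNIV)"
  have Q0: "Q0 \<in> ?T" "?E Q0 D = 0"
  proof -
    show "Q0 \<in> ?T" unfolding Q0_def using \<xi>s by (rule graph_plan)
    have "mdist M (\<xi>s i) (\<xi>s i) = 0" for i using \<xi>s by simp
    then show "?E Q0 D = 0" unfolding Q0_def E_graph D_def by simp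
  qed
  have \<phi>_ge: "\<phi> Q t \<ge> - t * \<alpha>" for Q t
    unfolding \<phi>_def by (simp add: integral_nonneg_AE)
  have cont: "continuous_on UNIV (\<phi> Q)" if "Q \<in> ?T" for Q
  proof -
    have "\<phi> Q = (\<lambda>t. (\<Sum>z\<in>set_pmf Q. max (f (snd z) + t) 0 * pmf Q z) - t * \<alpha>)"
      unfolding \<phi>_def using that
      by (intro ext arg_cong2[where f = "(-)"] integral_measure_pmf_real) (auto simp: transport_plans_def)
    then show ?thesis by (auto intro!: continuous_intros)
  qed
  \<comment> \<open>Since \<open>\<phi> Q0 t \<ge> - (B * \<alpha>)\<close> for
    \<open>t \<le> B\<close>, having \<open>\<Lambda> * T = B * \<alpha> + 1\<close> outweighs, with
    1 to spare, what mixing with \<open>Q0\<close> can lose.\<close>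
  define \<Lambda> where "\<Lambda> = (B * \<alpha> + 1) / T"
  have \<Lambda>: "\<Lambda> > 0" "\<Lambda> * T = B * \<alpha> + 1"
    using T \<alpha> \<open>B \<ge> 0\<close> by (auto simp: \<Lambda>_def add_nonneg_pos)
  \<comment> \<open>Values of \<open>t\<close> outside \<open>{-1..B}\<close> are harmless: to the
    left \<open>- t * \<alpha>\<close> is at least \<open>\<alpha>\<close>, and beyond
    \<open>B\<close> the positive part is inactive. Of the price range only the end points 0 and
    \<open>\<Lambda>\<close> are used later.\<close>
  obtain Q where Q: "Q \<in> ?T" "\<And>k. k \<in> {-1..B} \<times> {0..\<Lambda>} \<Longrightarrow> L Q k > 0"
  proof (rule convex_family_uniformly_positive[of "{-1..B} \<times> {0..\<Lambda>}" "L ` ?T"])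
    show "compact ({-1..B} \<times> {0..\<Lambda>})" by (intro compact_Times) auto
    show "convex ({-1..B} \<times> {0..\<Lambda>})" by (intro convex_Times) auto
    show "L ` ?T \<noteq> {}" using Q0 by auto
    show "(\<lambda>k. w * g k + (1 - w) * h k) \<in> L ` ?T"
      if "g \<in> L ` ?T" "h \<in> L ` ?T" "0 \<le> w" "w \<le> 1" for g h w
    proof -
      obtain Q1 Q2 where Q12: "Q1 \<in> ?T" "Q2 \<in> ?T" "g = L Q1" "h = L Q2" using \<open>g \<in> _\<close> \<open>h \<in> _\<close> by auto
      obtain Q where Q: "Q \<in> ?T" "\<And>v :: _ \<Rightarrow> real. ?E Q v = w * ?E Q1 v + (1 - w) * ?E Q2 v"
        using transport_plans_mix[OF Q12(1,2) \<open>0 \<le> w\<close> \<open>w \<le> 1\<close>] by blast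
      have "(\<lambda>k. w * g k + (1 - w) * h k) = L Q"
        by (rule ext) (simp add: Q12 L_def \<phi>_def Q(2), simp add: algebra_simps)
      then show ?thesis using Q(1) by blast
    qed
    show "convex_on ({-1..B} \<times> {0..\<Lambda>}) g" if g: "g \<in> L ` ?T" for g
    proof -
      obtain Q where "Q \<in> ?T" "g = L Q" using g by auto
      have "L Q (u *\<^sub>R x + v *\<^sub>R y) \<le> u * L Q x + v * L Q y"
        if uv: "0 \<le> u" "0 \<le> v" "u + v = 1" for x y and u v :: real
      proof -
        \<comment> \<open>Convexity in \<open>t\<close> comes from the positive part; the rest of
          \<open>L\<close> is affine in the multipliers.\<close>
        have "max (a + (u * s + v * t)) 0 \<le> u * max (a + s) 0 + v * max (a + t) 0" for a s t
        proof -
          have "u * (a + s) \<le> u * max (a + s) 0" "v * (a + t) \<le> v * max (a + t) 0"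
            "0 \<le> u * max (a + s) 0" "0 \<le> v * max (a + t) 0"
            using uv by (auto intro: mult_left_mono)
          moreover have "u * (a + s) + v * (a + t) = (u + v) * a + (u * s + v * t)"
            by (simp add: algebra_simps)
          then have "a + (u * s + v * t) = u * (a + s) + v * (a + t)"
            using uv(3) by simp
          ultimately show ?thesis by linarith
        qed
        then have "?E Q (\<lambda>z. max (f (snd z) + (u * fst x + v * fst y)) 0)
            \<le> ?E Q (\<lambda>z. u * max (f (snd z) + fst x) 0 + v * max (f (snd z) + fst y) 0)"
          by (intro integral_mono int[OF \<open>Q \<in> ?T\<close>])
        also have "\<dots> = u * ?E Q (\<lambda>z. max (f (snd z) + fst x) 0) + v * ?E Q (\<lambda>z. max (f (snd z) + fst y) 0)"
          by (subst Bochner_Integration.integral_add) (auto intro: int[OF \<open>Q \<in> ?T\<close>])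
        finally show ?thesis by (simp add: L_def \<phi>_def algebra_simps)
      qed
      then show ?thesis
        unfolding convex_on_def \<open>g = L Q\<close> by (auto intro!: convex_Times)
    qed
    show "continuous_on UNIV g" if g: "g \<in> L ` ?T" for g
    proof -
      obtain Q where "Q \<in> ?T" "g = L Q" using g by auto
      have "continuous_on UNIV (\<lambda>k. \<phi> Q (fst k) - snd k * (?E Q D - T))"
        by (intro continuous_intros continuous_on_compose2[OF cont[OF \<open>Q \<in> ?T\<close>]]) auto
      then show ?thesis by (simp add: \<open>g = L Q\<close> L_def[abs_def])
    qed
    show "\<exists>g\<in>L ` ?T. g k > 0" if k_in: "k \<in> {-1..B} \<times> {0..\<Lambda>}" for k
    proof -
      obtain t l where k: "k = (t, l)" and "l \<ge> 0" using k_in by auto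
      \<comment> \<open>The positive part inside \<open>v\<close> makes its supremum
        \<open>s i\<close> satisfy both constraints of the program at once: it dominates the
        penalised \<open>f + t\<close>, and it is nonnegative by evaluation at the sample
        itself.\<close>
      define v where "v i \<xi> = max (f \<xi> + t) 0 - l * mdist M \<xi> (\<xi>s i) powr p" for i \<xi>
      define s where "s i = (SUP \<xi>\<in>mspace M. v i \<xi>)" for i
      have bdd: "bdd_above (v i ` mspace M)" for i
      proof (rule bdd_aboveI2)
        fix \<xi> assume "\<xi> \<in> mspace M"
        moreover have "0 \<le> l * mdist M \<xi> (\<xi>s i) powr p" using \<open>l \<ge> 0\<close> by simp
        ultimately show "v i \<xi> \<le> B + \<bar>t\<bar>"
          using bd[of \<xi>] \<open>B \<ge> 0\<close> unfolding v_def by linarith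
      qed
      have v_le: "v i \<xi> \<le> s i" if "\<xi> \<in> mspace M" for i \<xi>
        unfolding s_def using that by (intro cSUP_upper bdd)
      have "s i \<ge> 0" for i
      proof -
        have "mdist M (\<xi>s i) (\<xi>s i) = 0" using \<xi>s by simp
        then show ?thesis using v_le[OF \<xi>s, of i i] by (simp add: v_def)
      qed
      moreover have "f \<xi> + t - l * mdist M \<xi> (\<xi>s i) powr p \<le> s i" if "\<xi> \<in> mspace M" for i \<xi>
        using v_le[OF that, of i] unfolding v_def by linarith
      ultimately have "t * \<alpha> < l * T + (\<Sum>i\<in>UNIV. s i) / real CARD('k)"
        unfolding T_def by (intro gap \<open>l \<ge> 0\<close>)
      moreover define e where "e = l * T + (\<Sum>i\<in>UNIV. s i) / real CARD('k) - t * \<alpha>"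
      ultimately have "e > 0" by simp
      \<comment> \<open>Each sample is sent to a point optimal up to \<open>e\<close>, the amount by
        which the program fails; the averaged loss stays below \<open>e\<close>, so the Lagrangian
        is positive.\<close>
      have "\<exists>\<xi>\<in>mspace M. s i - e < v i \<xi>" for i
        using less_cSUP_iff[OF _ bdd, of "s i - e" i] \<xi>s \<open>e > 0\<close> by (auto simp: s_def)
      then obtain h where h: "\<And>i. h i \<in> mspace M" "\<And>i. s i - e < v i (h i)" by metis
      define Q :: "('k \<times> 'a) pmf" where "Q = map_pmf (\<lambda>i. (i, h i)) (pmf_of_set UNIV)"
      have "(\<Sum>i\<in>UNIV. s i) / real CARD('k) - e = (\<Sum>i\<in>UNIV. s i - e) / real CARD('k)"
        by (simp add: sum_subtractf diff_divide_distrib)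
      also have "\<dots> < (\<Sum>i\<in>UNIV. v i (h i)) / real CARD('k)"
        using h by (intro divide_strict_right_mono sum_strict_mono) auto
      also have "\<dots> = ?E Q (\<lambda>z. max (f (snd z) + t) 0) - l * ?E Q D"
        unfolding Q_def E_graph v_def D_def
        by (simp add: sum_subtractf diff_divide_distrib sum_distrib_left)
      finally have "L Q k > 0"
        by (simp add: L_def \<phi>_def k e_def algebra_simps)
      then show ?thesis using graph_plan[of h] h by (auto simp: Q_def)
    qed
  qed (use that in blast)
  \<comment> \<open>A plan that is too expensive is mixed with the plan that does not move any mass; the size of
    \<open>\<Lambda>\<close> makes up for what this costs in the objective.\<close>
  obtain Q' where Q': "Q' \<in> ?T" "?E Q' D \<le> T" and Q'_pos: "\<And>t. t \<in> {-1..B} \<Longrightarrow> \<phi> Q' t > 0"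
  proof (cases "?E Q D \<le> T")
    case True
    \<comment> \<open>At price 0 the Lagrangian is the objective itself.\<close>
    moreover have "\<phi> Q t > 0" if "t \<in> {-1..B}" for t
      using Q(2)[of "(t, 0)"] that \<Lambda> by (simp add: L_def)
    ultimately show thesis using that Q by blast
  next
    case False
    \<comment> \<open>Because \<open>Q0\<close> costs nothing, this weight makes the mixture cost
      exactly \<open>T\<close>.\<close>
    define w where "w = T / ?E Q D"
    have w: "0 < w" "w < 1" "w * ?E Q D = T"
      using False T by (auto simp: w_def)
    obtain R where R: "R \<in> ?T" "\<And>v :: _ \<Rightarrow> real. ?E R v = w * ?E Q v + (1 - w) * ?E Q0 v"
      using transport_plans_mix[OF Q(1) Q0(1), of w] w by (metis less_imp_le)
    have "\<phi> R t > 0" if t: "t \<in> {-1..B}" for t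
    proof -
      \<comment> \<open>The other end of the price range: the excess cost of \<open>Q\<close> comes
        with a surplus in the objective which, scaled by \<open>w\<close>, exceeds
        \<open>(1 - w) * (\<Lambda> * T)\<close>.\<close>
      have "\<phi> Q t > \<Lambda> * (?E Q D - T)"
        using Q(2)[of "(t, \<Lambda>)"] t \<Lambda> by (simp add: L_def)
      then have "w * (\<Lambda> * (?E Q D - T)) < w * \<phi> Q t" using w by simp
      also have "w * (\<Lambda> * (?E Q D - T)) = \<Lambda> * (w * ?E Q D - w * T)" by (simp add: algebra_simps)
      also have "\<dots> = (1 - w) * (\<Lambda> * T)" unfolding w(3) by (simp add: algebra_simps)
      also have "\<dots> = (1 - w) * (B * \<alpha> + 1)" by (simp only: \<Lambda>(2))
      finally have "(1 - w) * (B * \<alpha> + 1) < w * \<phi> Q t" .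
      moreover have "(1 - w) * (- (B * \<alpha>)) \<le> (1 - w) * \<phi> Q0 t"
      proof (intro mult_left_mono)
        have "t * \<alpha> \<le> B * \<alpha>" using t \<alpha> by (intro mult_right_mono) auto
        then show "- (B * \<alpha>) \<le> \<phi> Q0 t" using \<phi>_ge[of t Q0] by simp
      qed (use w in simp)
      moreover have "\<phi> R t = w * \<phi> Q t + (1 - w) * \<phi> Q0 t"
        by (simp add: \<phi>_def R(2) algebra_simps)
      ultimately show ?thesis using w by (simp add: algebra_simps)
    qed
    moreover have "?E R D \<le> T" using R(2)[of D] w Q0 by simp
    ultimately show thesis using that R(1) by blast
  qed
  obtain P where P: "P \<in> wasserstein_ball p \<theta> M \<xi>s"
    "\<And>f :: 'a \<Rightarrow> real. f \<in> borel_measurable (borel_of_metric M) \<Longrightarrow>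
      (\<integral>\<xi>. f \<xi> \<partial>P) = ?E Q' (\<lambda>z. f (snd z))"
    using transport_plan_in_wasserstein_ball[where \<xi>s = \<xi>s, OF sep \<xi>s p \<theta> Q'(1)] Q'(2)
    unfolding D_def[abs_def] T_def by blast
  have "{-1..B} \<noteq> {}" using \<open>B \<ge> 0\<close> by auto
  then obtain t0 where t0: "t0 \<in> {-1..B}" "\<And>t. t \<in> {-1..B} \<Longrightarrow> \<phi> Q' t0 \<le> \<phi> Q' t"
    using continuous_attains_inf[of "{-1..B}" "\<phi> Q'"] continuous_on_subset[OF cont[OF Q'(1)]] by auto
  \<comment> \<open>A bound uniform in \<open>t\<close>: the minimum over the interval is attained
    and positive, and \<open>\<alpha>\<close> covers \<open>t < -1\<close>.\<close>
  define e where "e = min (\<phi> Q' t0) \<alpha>"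
  have "e > 0" using Q'_pos[OF t0(1)] \<alpha> by (simp add: e_def)
  have e_le: "e \<le> \<phi> Q' t" for t
  proof -
    consider "t \<in> {-1..B}" | "t < -1" | "t > B" by fastforce
    then show ?thesis
    proof cases
      case 1
      then show ?thesis using t0(2)[of t] by (simp add: e_def)
    next
      case 2
      then have "1 * \<alpha> \<le> - t * \<alpha>" using \<alpha> by (intro mult_right_mono) auto
      then show ?thesis using \<phi>_ge[of t Q'] by (simp add: e_def)
    next
      case 3
      \<comment> \<open>On the support \<open>f \<ge> - B\<close>, so beyond \<open>B\<close> the
        positive part is inactive and \<open>\<phi> Q'\<close> grows with slope
        \<open>1 - \<alpha> > 0\<close> from its value at \<open>B\<close>.\<close>
      have "?E Q' (\<lambda>z. max (f (snd z) + t) 0) = ?E Q' (\<lambda>z. max (f (snd z) + B) 0 + (t - B))"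
      proof (intro integral_cong_AE)
        show "AE z in measure_pmf Q'. max (f (snd z) + t) 0 = max (f (snd z) + B) 0 + (t - B)"
          unfolding AE_measure_pmf_iff
        proof
          fix z assume "z \<in> set_pmf Q'"
          then have "snd z \<in> mspace M" using Q'(1) by (auto simp: transport_plans_def)
          then show "max (f (snd z) + t) 0 = max (f (snd z) + B) 0 + (t - B)"
            using bd[of "snd z"] 3 by linarith
        qed
      qed auto
      also have "\<dots> = ?E Q' (\<lambda>z. max (f (snd z) + B) 0) + (t - B)"
        by (subst Bochner_Integration.integral_add) (auto intro: int[OF Q'(1)])
      finally have "\<phi> Q' t - \<phi> Q' B = (t - B) * (1 - \<alpha>)"
        by (simp add: \<phi>_def algebra_simps)
      moreover have "(t - B) * (1 - \<alpha>) \<ge> 0" using 3 \<alpha> by simp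
      ultimately show ?thesis using t0(2)[of B] \<open>B \<ge> 0\<close> by (simp add: e_def)
    qed
  qed
  have "0 < ereal e" using \<open>e > 0\<close> by simp
  also have "ereal e \<le> (INF t. ereal ((\<integral>\<xi>. max (f \<xi> + t) 0 \<partial>P) - t * \<alpha>))"
  proof (intro INF_greatest)
    fix t
    have "(\<integral>\<xi>. max (f \<xi> + t) 0 \<partial>P) - t * \<alpha> = \<phi> Q' t"
      unfolding \<phi>_def by (subst P(2)) auto
    then show "ereal e \<le> ereal ((\<integral>\<xi>. max (f \<xi> + t) 0 \<partial>P) - t * \<alpha>)" using e_le by simp
  qed
  finally show thesis by (rule that[OF P(1)])
qed

section \<open>The convex program\<close>

lemma worst_case_le_iff:
  "worst_case p M F \<zeta> x l t \<le> ereal r \<longleftrightarrow>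
    (\<forall>\<xi>\<in>mspace M. F x \<xi> + t - l * mdist M \<xi> \<zeta> powr p \<le> r)"
  by (simp add: worst_case_def SUP_le_iff)

text \<open>Boundedness of \<open>F x\<close> bounds the supremum above, and the value at
  \<open>\<zeta>\<close> bounds it below. This legitimises \<open>real_of_ereal\<close> in the
  convexity statements.\<close>

lemma worst_case_finite:
  assumes "bounded (F x ` mspace M)" "\<zeta> \<in> mspace M" "l \<ge> 0"
  shows "\<bar>worst_case p M F \<zeta> x l t\<bar> \<noteq> \<infinity>"
proof -
  obtain B where B: "\<And>\<xi>. \<xi> \<in> mspace M \<Longrightarrow> \<bar>F x \<xi>\<bar> \<le> B"
    using assms(1) by (auto simp: bounded_iff)
  have "worst_case p M F \<zeta> x l t \<le> ereal (B + t)"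
    unfolding worst_case_le_iff
  proof
    fix \<xi> assume "\<xi> \<in> mspace M"
    moreover have "0 \<le> l * mdist M \<xi> \<zeta> powr p" using \<open>l \<ge> 0\<close> by simp
    ultimately show "F x \<xi> + t - l * mdist M \<xi> \<zeta> powr p \<le> B + t" using B[of \<xi>] by linarith
  qed
  moreover have "ereal (F x \<zeta> + t - l * mdist M \<zeta> \<zeta> powr p) \<le> worst_case p M F \<zeta> x l t"
    unfolding worst_case_def using assms(2) by (rule SUP_upper)
  ultimately show ?thesis by auto
qed

lemma program_domain_iff:
  "(x, l, t, s) \<in> program_domain X \<longleftrightarrow> x \<in> X \<and> l \<ge> 0 \<and> (\<forall>i. s $ i \<ge> 0)"
  by (simp add: program_domain_def)

lemma convex_program_domain:
  assumes "convex X"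
  shows "convex (program_domain X)"
  using assms unfolding convex_def by (auto simp: program_domain_def)

text \<open>For fixed \<open>\<xi>\<close> the expression under the supremum is jointly convex in
  \<open>(x, l, t)\<close>: \<open>F\<close> is convex in \<open>x\<close> and the distance term is
  linear in \<open>l\<close>. A finite supremum of convex functions is convex.\<close>

lemma convex_on_worst_case:
  fixes X :: "'x::real_vector set" and \<xi>s :: "'k::finite \<Rightarrow> 'a"
  assumes "convex X" and cvx: "\<And>\<xi>. \<xi> \<in> mspace M \<Longrightarrow> convex_on X (\<lambda>x. F x \<xi>)"
    and bd: "\<And>x. x \<in> X \<Longrightarrow> bounded (F x ` mspace M)" and \<zeta>: "\<zeta> \<in> mspace M"
  shows "convex_on (program_domain X)
    (\<lambda>(x, l, t, s :: real ^ 'k). real_of_ereal (worst_case p M F \<zeta> x l t) - s $ i)"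
  unfolding convex_on_def
proof (intro conjI convex_program_domain \<open>convex X\<close> ballI allI impI)
  fix z z' :: "'x \<times> real \<times> real \<times> (real ^ 'k)" and u v :: real
  assume z: "z \<in> program_domain X" "z' \<in> program_domain X" and uv: "0 \<le> u" "0 \<le> v" "u + v = 1"
  obtain x l t s x' l' t' s' where zz: "z = (x, l, t, s)" "z' = (x', l', t', s')"
    by (metis prod_cases4)
  have x: "x \<in> X" "l \<ge> 0" "x' \<in> X" "l' \<ge> 0" using z by (auto simp: zz program_domain_iff)
  define W where "W x l t = real_of_ereal (worst_case p M F \<zeta> x l t)" for x l t
  have W: "worst_case p M F \<zeta> x l t = ereal (W x l t)" if "x \<in> X" "l \<ge> 0" for x l t
    using worst_case_finite[of F x M \<zeta> l p t] bd[OF that(1)] \<zeta> that unfolding W_def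
    by (simp add: ereal_real)
  have le_W: "F x \<xi> + t - l * mdist M \<xi> \<zeta> powr p \<le> W x l t"
    if "x \<in> X" "l \<ge> 0" "\<xi> \<in> mspace M" for x l t \<xi>
    using worst_case_le_iff[of p M F \<zeta> x l t "W x l t"] W[of x l t] that by auto
  have "worst_case p M F \<zeta> (u *\<^sub>R x + v *\<^sub>R x') (u * l + v * l') (u * t + v * t')
      \<le> ereal (u * W x l t + v * W x' l' t')"
    unfolding worst_case_le_iff
  proof
    fix \<xi> assume \<xi>: "\<xi> \<in> mspace M"
    let ?d = "mdist M \<xi> \<zeta> powr p"
    have "F (u *\<^sub>R x + v *\<^sub>R x') \<xi> \<le> u * F x \<xi> + v * F x' \<xi>"
      using cvx[OF \<xi>] x uv by (auto simp: convex_on_def)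
    moreover have "u * (F x \<xi> + t - l * ?d) + v * (F x' \<xi> + t' - l' * ?d) \<le> u * W x l t + v * W x' l' t'"
      using x uv \<xi> by (intro add_mono mult_left_mono le_W)
    ultimately show "F (u *\<^sub>R x + v *\<^sub>R x') \<xi> + (u * t + v * t') - (u * l + v * l') * ?d
        \<le> u * W x l t + v * W x' l' t'"
      by (simp add: algebra_simps)
  qed
  moreover have "u *\<^sub>R x + v *\<^sub>R x' \<in> X" "u * l + v * l' \<ge> 0"
    using x uv \<open>convex X\<close> by (auto simp: convex_def)
  ultimately have "W (u *\<^sub>R x + v *\<^sub>R x') (u * l + v * l') (u * t + v * t') \<le> u * W x l t + v * W x' l' t'"
    by (simp add: W)
  then show "(case u *\<^sub>R z + v *\<^sub>R z' of
        (x, l, t, s) \<Rightarrow> real_of_ereal (worst_case p M F \<zeta> x l t) - s $ i)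
      \<le> u * (case z of (x, l, t, s) \<Rightarrow> real_of_ereal (worst_case p M F \<zeta> x l t) - s $ i) +
        v * (case z' of (x, l, t, s) \<Rightarrow> real_of_ereal (worst_case p M F \<zeta> x l t) - s $ i)"
    by (simp add: zz W_def algebra_simps)
qed

lemma convex_on_budget_constraint:
  fixes X :: "'x::real_vector set"
  assumes "convex X"
  shows "convex_on (program_domain X)
    (\<lambda>(x, l, t, s :: real ^ 'k). l * T + (\<Sum>i\<in>UNIV. s $ i) / real CARD('k) - t * \<alpha>)"
  unfolding convex_on_def
  by (auto intro!: convex_program_domain assms
      simp: sum.distrib sum_distrib_left[symmetric] add_divide_distrib algebra_simps)

lemma convex_on_objective:
  fixes X :: "'x::real_inner set"
  assumes "convex X"
  shows "convex_on (program_domain X :: ('x \<times> real \<times> real \<times> (real ^ 'k)) set) (\<lambda>(x, l, t, s). c \<bullet> x)"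
  unfolding convex_on_def
  by (auto intro!: convex_program_domain assms simp: inner_add_right)

text \<open>An intersection of sublevel sets of the convex constraint functions.\<close>

lemma convex_program_feasible:
  fixes X :: "'x::real_vector set" and \<xi>s :: "'k::finite \<Rightarrow> 'a"
  assumes "convex X" and "\<And>\<xi>. \<xi> \<in> mspace M \<Longrightarrow> convex_on X (\<lambda>x. F x \<xi>)"
    and bd: "\<And>x. x \<in> X \<Longrightarrow> bounded (F x ` mspace M)" and \<xi>s: "\<And>i. \<xi>s i \<in> mspace M"
  shows "convex (program_feasible p \<theta> \<alpha> M \<xi>s X F)"
proof -
  \<comment> \<open>Finiteness lets the extended real constraint be rewritten with real functions;
    for an infinite value \<open>real_of_ereal\<close> would return 0.\<close>
  have wc: "worst_case p M F (\<xi>s i) x l t \<le> ereal r \<longleftrightarrow>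
      real_of_ereal (worst_case p M F (\<xi>s i) x l t) - r \<le> 0" if "x \<in> X" "l \<ge> 0" for x l t r i
    using worst_case_finite[of F x M "\<xi>s i" l p t, OF bd[OF that(1)] \<xi>s that(2)]
    by (cases "worst_case p M F (\<xi>s i) x l t") auto
  have "program_feasible p \<theta> \<alpha> M \<xi>s X F =
      {z \<in> program_domain X. (\<lambda>(x, l, t, s :: real ^ 'k).
          l * \<theta> powr p + (\<Sum>i\<in>UNIV. s $ i) / real CARD('k) - t * \<alpha>) z \<le> 0} \<inter>
      (\<Inter>i. {z \<in> program_domain X. (\<lambda>(x, l, t, s :: real ^ 'k).
          real_of_ereal (worst_case p M F (\<xi>s i) x l t) - s $ i) z \<le> 0})"
    by (auto simp: program_feasible_def program_domain_iff wc)
  then show ?thesis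
    using assms
    by (auto intro!: convex_Int convex_INT convex_on_lower_level_set convex_on_budget_constraint
        convex_on_worst_case)
qed

text \<open>With \<open>x\<close> fixed, weak duality for the positive part of
  \<open>F x + t\<close> and strong duality for \<open>F x\<close> give one direction each.\<close>

lemma X_CDCP_iff_program_feasible:
  fixes \<xi>s :: "'k::finite \<Rightarrow> 'a" and X :: "'x::topological_space set"
  assumes sep: "separable_space (mtopology_of M)" and \<xi>s: "\<And>i. \<xi>s i \<in> mspace M"
    and p: "p \<ge> 1" and \<theta>: "\<theta> > 0" and \<alpha>: "0 < \<alpha>" "\<alpha> < 1"
    and F: "continuous_map (prod_topology euclidean (mtopology_of M)) euclidean (\<lambda>(x, \<xi>). F x \<xi>)"
    and bd: "\<And>x. x \<in> X \<Longrightarrow> bounded (F x ` mspace M)"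
  shows "x \<in> X_CDCP p \<theta> \<alpha> M \<xi>s X F \<longleftrightarrow>
    (\<exists>l t s. (x, l, t, s) \<in> program_feasible p \<theta> \<alpha> M \<xi>s X F)"
proof
  have "continuous_map (mtopology_of M) euclidean ((\<lambda>(x, \<xi>). F x \<xi>) \<circ> (\<lambda>\<xi>. (x, \<xi>)))"
    by (rule continuous_map_compose[OF _ F]) (auto simp: continuous_map_pairwise comp_def)
  then have meas [measurable]: "F x \<in> borel_measurable (borel_of_metric M)"
    by (intro measurable_borel_of_metric_continuous) (simp add: comp_def)
  {
    assume "\<exists>l t s. (x, l, t, s) \<in> program_feasible p \<theta> \<alpha> M \<xi>s X F"
    then obtain l t s where "x \<in> X" and l: "l \<ge> 0" and s: "\<And>i. s $ i \<ge> 0"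
      and budget: "l * \<theta> powr p + (\<Sum>i\<in>UNIV. s $ i) / real CARD('k) \<le> t * \<alpha>"
      and wc: "\<And>i. worst_case p M F (\<xi>s i) x l t \<le> ereal (s $ i)"
      by (auto simp: program_feasible_def program_domain_def)
    have "(INF t. ereal ((\<integral>\<xi>. max (F x \<xi> + t) 0 \<partial>P) - t * \<alpha>)) \<le> 0"
      if P: "P \<in> wasserstein_ball p \<theta> M \<xi>s" for P
    proof (rule INF_lower2)
      \<comment> \<open>The \<open>t\<close> of the feasible point is the candidate in the inner
        infimum, the same for all \<open>P\<close>.\<close>
      have "(\<integral>\<xi>. max (F x \<xi> + t) 0 \<partial>P) \<le> l * \<theta> powr p + (\<Sum>i\<in>UNIV. s $ i) / real CARD('k)"
      proof (rule wasserstein_weak_duality[OF sep \<xi>s p \<theta> P _ _ l s])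
        fix i \<xi> assume "\<xi> \<in> mspace M"
        then have "F x \<xi> + t - l * mdist M \<xi> (\<xi>s i) powr p \<le> s $ i"
          using wc[of i] by (simp add: worst_case_le_iff)
        \<comment> \<open>The constraint bounds only \<open>F x \<xi> + t\<close>; nonnegativity of
          \<open>s\<close> and \<open>l\<close> extends the bound to the positive part.\<close>
        moreover have "0 \<le> s $ i + l * mdist M \<xi> (\<xi>s i) powr p" using l s by simp
        ultimately show "max (F x \<xi> + t) 0 \<le> s $ i + l * mdist M \<xi> (\<xi>s i) powr p" by simp
      qed auto
      then show "ereal ((\<integral>\<xi>. max (F x \<xi> + t) 0 \<partial>P) - t * \<alpha>) \<le> 0" using budget by simp
    qed simp
    then show "x \<in> X_CDCP p \<theta> \<alpha> M \<xi>s X F"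
      using \<open>x \<in> X\<close> by (simp add: X_CDCP_def SUP_le_iff)
  }
  assume x: "x \<in> X_CDCP p \<theta> \<alpha> M \<xi>s X F"
  then have "x \<in> X" by (simp add: X_CDCP_def)
  obtain B where B: "\<And>\<xi>. \<xi> \<in> mspace M \<Longrightarrow> \<bar>F x \<xi>\<bar> \<le> B"
    using bd[OF \<open>x \<in> X\<close>] by (auto simp: bounded_iff)
  show "\<exists>l t s. (x, l, t, s) \<in> program_feasible p \<theta> \<alpha> M \<xi>s X F"
  proof (rule ccontr)
    assume infeasible: "\<nexists>l t s. (x, l, t, s) \<in> program_feasible p \<theta> \<alpha> M \<xi>s X F"
    have gap: "t * \<alpha> < l * \<theta> powr p + (\<Sum>i\<in>UNIV. s i) / real CARD('k)"
      if "l \<ge> 0" "\<And>i. s i \<ge> 0"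
        "\<And>i \<xi>. \<xi> \<in> mspace M \<Longrightarrow> F x \<xi> + t - l * mdist M \<xi> (\<xi>s i) powr p \<le> s i" for l t s
    proof -
      have "(x, l, t, \<chi> i. s i) \<notin> program_feasible p \<theta> \<alpha> M \<xi>s X F" using infeasible by blast
      then show ?thesis
        using that \<open>x \<in> X\<close> by (auto simp: program_feasible_def program_domain_def worst_case_le_iff not_le)
    qed
    show False
    proof (rule wasserstein_strong_duality[of M \<xi>s p \<theta> \<alpha> "F x" B])
      fix P assume P: "P \<in> wasserstein_ball p \<theta> M \<xi>s"
        and pos: "0 < (INF t. ereal ((\<integral>\<xi>. max (F x \<xi> + t) 0 \<partial>P) - t * \<alpha>))"
      have "(SUP P\<in>wasserstein_ball p \<theta> M \<xi>s.
          INF t. ereal ((\<integral>\<xi>. max (F x \<xi> + t) 0 \<partial>P) - t * \<alpha>)) \<le> 0"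
        using x by (simp only: X_CDCP_def mem_Collect_eq)
      from leD[OF order_trans[OF SUP_upper[OF P] this]] pos show False by (rule notE)
    qed (fact sep \<xi>s p \<theta> \<alpha> meas B gap)+
  qed
qed

theorem mainTheorem2:
  fixes M :: "(real ^ 'm) metric"
    and p \<theta> \<alpha> :: real
    and c :: "real ^ 'n"
    and X :: "(real ^ 'n) set"
    and \<xi>s :: "'k::finite \<Rightarrow> real ^ 'm"
    and F :: "real ^ 'n \<Rightarrow> real ^ 'm \<Rightarrow> real"
  assumes "mcomplete_of M" and "separable_space (mtopology_of M)"
    and "p \<ge> 1" and "\<theta> > 0" and "0 < \<alpha>" and "\<alpha> < 1"
    and "closed X" and "convex X"
    and "\<And>i. \<xi>s i \<in> mspace M"
    and "continuous_map (prod_topology euclidean (mtopology_of M)) euclidean (\<lambda>(x, \<xi>). F x \<xi>)"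
    and "\<And>\<xi>. \<xi> \<in> mspace M \<Longrightarrow> convex_on X (\<lambda>x. F x \<xi>)"
    and "\<And>x. x \<in> X \<Longrightarrow> bounded (F x ` mspace M)"
  shows
    \<comment> \<open>feasibility\<close>
    "(\<forall>x. x \<in> X_CDCP p \<theta> \<alpha> M \<xi>s X F \<longleftrightarrow>
          (\<exists>l t s. (x, l, t, s) \<in> program_feasible p \<theta> \<alpha> M \<xi>s X F))
     \<and> \<comment> \<open>optimal values\<close>
     (INF x\<in>X_CDCP p \<theta> \<alpha> M \<xi>s X F. ereal (c \<bullet> x)) =
       (INF (x, l, t, s)\<in>program_feasible p \<theta> \<alpha> M \<xi>s X F. ereal (c \<bullet> x))
     \<and> \<comment> \<open>minimizers\<close>
     (\<forall>x. is_arg_min (\<lambda>x. c \<bullet> x) (\<lambda>x. x \<in> X_CDCP p \<theta> \<alpha> M \<xi>s X F) x \<longleftrightarrow>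
          (\<exists>l t s. is_arg_min (\<lambda>(x, l, t, s). c \<bullet> x)
                     (\<lambda>z. z \<in> program_feasible p \<theta> \<alpha> M \<xi>s X F) (x, l, t, s)))
     \<and> \<comment> \<open>the program is convex: objective and (finite) constraint functions on a convex domain\<close>
     convex (program_domain X :: ((real ^ 'n) \<times> real \<times> real \<times> (real ^ 'k)) set)
     \<and> convex_on (program_domain X)
         (\<lambda>(x, l :: real, t :: real, s :: real ^ 'k). c \<bullet> x)
     \<and> convex_on (program_domain X)
         (\<lambda>(x :: real ^ 'n, l, t, s :: real ^ 'k).
            l * \<theta> powr p + (\<Sum>i\<in>UNIV. s $ i) / real CARD('k) - t * \<alpha>)
     \<and> (\<forall>i. (\<forall>x\<in>X. \<forall>l\<ge>0. \<forall>t. \<bar>worst_case p M F (\<xi>s i) x l t\<bar> \<noteq> \<infinity>)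
          \<and> convex_on (program_domain X)
              (\<lambda>(x, l, t, s :: real ^ 'k).
                 real_of_ereal (worst_case p M F (\<xi>s i) x l t) - s $ i))
     \<and> convex (program_feasible p \<theta> \<alpha> M \<xi>s X F)"
proof -
  let ?X = "X_CDCP p \<theta> \<alpha> M \<xi>s X F" and ?Z = "program_feasible p \<theta> \<alpha> M \<xi>s X F"
  have feas: "x \<in> ?X \<longleftrightarrow> (\<exists>l t s. (x, l, t, s) \<in> ?Z)" for x
    by (rule X_CDCP_iff_program_feasible) fact+
  \<comment> \<open>The objective sees only \<open>x\<close>, so the optimal values agree along this
    projection.\<close>
  have "?X = fst ` ?Z" using feas by force
  then have opt: "(INF x\<in>?X. ereal (c \<bullet> x)) = (INF (x, l, t, s)\<in>?Z. ereal (c \<bullet> x))"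
    by (simp add: image_image case_prod_beta)
  have arg_min: "is_arg_min (\<lambda>x. c \<bullet> x) (\<lambda>x. x \<in> ?X) x \<longleftrightarrow>
      (\<exists>l t s. is_arg_min (\<lambda>(x, l, t, s). c \<bullet> x) (\<lambda>z. z \<in> ?Z) (x, l, t, s))" for x
    by (simp add: is_arg_min_def feas split_paired_All)
  have finite: "\<bar>worst_case p M F (\<xi>s i) x l t\<bar> \<noteq> \<infinity>" if "x \<in> X" "l \<ge> 0" for i x l t
    by (intro worst_case_finite assms that)
  have convex: "convex_on (program_domain X)
      (\<lambda>(x, l, t, s :: real ^ 'k). real_of_ereal (worst_case p M F (\<xi>s i) x l t) - s $ i)" for i
    by (rule convex_on_worst_case) fact+
  have "convex ?Z"
    by (rule convex_program_feasible) fact+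
  then show ?thesis
    by (intro conjI allI ballI impI feas opt arg_min finite convex convex_program_domain
        convex_on_objective convex_on_budget_constraint \<open>convex X\<close>)
qed

end
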